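(* Let $\mathcal{X}$ be a Banach space and let $K\subset\mathcal{X}$ be an absolutely convex compact set such that the sequence $\{d_n(K)\}_{n=1}^\infty$ of Kolmogorov widths of $K$ is lacunary. Then $WG(K)=\mathcal{A}_K$.
   Context: $\mathcal{L}(\mathcal{X})$ is the space of bounded linear operators on $\mathcal{X}$. $G(K)=\{D\in\mathcal{L}(\mathcal{X}): DK\supset K\}$, and $WG(K)$ is the closure of $G(K)$ in the weak operator topology. $V_K=\overline{\mathrm{lin}(K)}$ is the norm-closed linear span of $K$, and $\mathcal{A}_K=\{T\in\mathcal{L}(\mathcal{X}): TV_K\subset V_K\}$. The Kolmogorov $n$-width of $K\subset \mathcal{X}$ is $d_n(K)=\inf_{\mathcal{X}_n}\sup_{x\in K}\inf_{z\in \mathcal{X}_n}\|x-z\|$, the outer infimum being over all $n$-dimensional linear subspaces $\mathcal{X}_n$ of $\mathcal{X}$. A non-increasing sequence $\{a_n\}$ of positive numbers with $\lim_{n\to\infty} a_n=0$ is called lacunary if $\liminf_{n\to\infty}a_{n+1}/a_n=0$. *)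

theory Defs
  imports "HOL-Analysis.Analysis"
begin

text \<open>
  Banach spaces are taken over the reals or the complex numbers. The scalar field is a type
  of class \<open>real_or_complex\<close>, whose types are, up to isometric isomorphism, exactly these two.
\<close>

class real_or_complex = real_normed_field +
  assumes isometric_to_real_or_complex:
    "\<exists>h :: 'a \<Rightarrow> complex.
       (\<forall>a b. h (a + b) = h a + h b) \<and> (\<forall>a b. h (a * b) = h a * h b) \<and>
       (\<forall>r. h (r *\<^sub>R 1) = of_real r) \<and> (\<forall>a. cmod (h a) = norm a) \<and>
       (range h = \<real> \<or> range h = UNIV)"

instance real :: real_or_complex
  by standard (rule exI[of _ complex_of_real], auto simp: Reals_def)

instance complex :: real_or_complex
  by standard (rule exI[of _ id], auto simp: scaleR_conv_of_real)

text \<open>The class \<open>banach\<close> provides the norm, its completeness and the multiplication by reals;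
  \<open>smul\<close> is the multiplication by scalars of the field, and extends the latter.\<close>

locale banach_space_over = vector_space smul
  for smul :: "'k::real_or_complex \<Rightarrow> 'a::banach \<Rightarrow> 'a" +
  assumes scale_of_real: "smul (of_real r) x = r *\<^sub>R x"
    and norm_scale: "norm (smul c x) = norm c * norm x"

lemma banach_space_over_scaleR:
  "banach_space_over (scaleR :: real \<Rightarrow> 'a::banach \<Rightarrow> 'a)"
  by unfold_locales (auto simp: algebra_simps)

lemma banach_space_over_complex:
  "banach_space_over ((*) :: complex \<Rightarrow> complex \<Rightarrow> complex)"
  by unfold_locales (auto simp: algebra_simps scaleR_conv_of_real norm_mult)

definition bounded_operators :: "('k::real_or_complex \<Rightarrow> 'a::banach \<Rightarrow> 'a) \<Rightarrow> ('a \<Rightarrow> 'a) set"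
  where "bounded_operators smul =
    {T. bounded_linear T \<and> (\<forall>c x. T (smul c x) = smul c (T x))}"

definition dual_space :: "('k::real_or_complex \<Rightarrow> 'a::banach \<Rightarrow> 'a) \<Rightarrow> ('a \<Rightarrow> 'k) set"
  where "dual_space smul =
    {f. bounded_linear f \<and> (\<forall>c x. f (smul c x) = c * f x)}"

definition weak_operator_topology ::
    "('k::real_or_complex \<Rightarrow> 'a::banach \<Rightarrow> 'a) \<Rightarrow> ('a \<Rightarrow> 'a) topology"
  where "weak_operator_topology smul = topology_generated_by
    {{T \<in> bounded_operators smul. f (T x) \<in> U} | f x U. f \<in> dual_space smul \<and> open U}"

definition absolutely_convex :: "('k::real_or_complex \<Rightarrow> 'a::banach \<Rightarrow> 'a) \<Rightarrow> 'a set \<Rightarrow> bool"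
  where "absolutely_convex smul K \<longleftrightarrow>
    convex K \<and> (\<forall>c. norm c \<le> 1 \<longrightarrow> smul c ` K \<subseteq> K)"

definition G_of :: "('k::real_or_complex \<Rightarrow> 'a::banach \<Rightarrow> 'a) \<Rightarrow> 'a set \<Rightarrow> ('a \<Rightarrow> 'a) set"
  where "G_of smul K = {D \<in> bounded_operators smul. K \<subseteq> D ` K}"

definition WG_of :: "('k::real_or_complex \<Rightarrow> 'a::banach \<Rightarrow> 'a) \<Rightarrow> 'a set \<Rightarrow> ('a \<Rightarrow> 'a) set"
  where "WG_of smul K = weak_operator_topology smul closure_of G_of smul K"

definition V_of :: "('k::real_or_complex \<Rightarrow> 'a::banach \<Rightarrow> 'a) \<Rightarrow> 'a set \<Rightarrow> 'a set"
  where "V_of smul K = closure (module.span smul K)"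

definition A_of :: "('k::real_or_complex \<Rightarrow> 'a::banach \<Rightarrow> 'a) \<Rightarrow> 'a set \<Rightarrow> ('a \<Rightarrow> 'a) set"
  where "A_of smul K = {T \<in> bounded_operators smul. T ` V_of smul K \<subseteq> V_of smul K}"

definition subspaces_of_dim ::
    "('k::real_or_complex \<Rightarrow> 'a::banach \<Rightarrow> 'a) \<Rightarrow> nat \<Rightarrow> 'a set set"
  where "subspaces_of_dim smul n =
    {module.span smul B | B. finite B \<and> card B = n \<and> \<not> module.dependent smul B}"

text \<open>The value is \<open>\<infinity>\<close> if the whole space has dimension less than \<open>n\<close>.\<close>

definition kolmogorov_width ::
    "('k::real_or_complex \<Rightarrow> 'a::banach \<Rightarrow> 'a) \<Rightarrow> nat \<Rightarrow> 'a set \<Rightarrow> ereal"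
  where "kolmogorov_width smul n K =
    (INF S \<in> subspaces_of_dim smul n. SUP x \<in> K. INF z \<in> S. ereal (norm (x - z)))"

text \<open>The terms have to be positive real numbers, so \<open>\<infinity>\<close> is excluded.\<close>

definition lacunary :: "(nat \<Rightarrow> ereal) \<Rightarrow> bool"
  where "lacunary a \<longleftrightarrow>
    (\<forall>n. 0 < a n \<and> a n < \<infinity>) \<and> decseq a \<and> a \<longlonglongrightarrow> 0 \<and>
    liminf (\<lambda>n. a (Suc n) / a n) = 0"

end

theory Submission
  imports Defs
begin

text \<open>
  Let \<open>Y\<close> be the linear span of \<open>K\<close> and \<open>V\<close> its closure.

  Suppose \<open>D K \<supseteq> K\<close> but \<open>D k\<^sub>0 \<notin> V\<close> for some \<open>k\<^sub>0 \<in> K\<close>, and let the functional \<open>g\<close> vanish on \<open>V\<close> with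
  \<open>g (D k\<^sub>0) = 1\<close>. If an \<open>(n+1)\<close>-dimensional subspace \<open>L\<close> is close to \<open>K\<close>, then the image under \<open>D\<close> of the
  \<open>n\<close>-dimensional subspace \<open>L \<inter> ker (g \<circ> D)\<close> is still close to \<open>K\<close>. So \<open>d\<^sub>n(K) \<le> C d\<^sub>n\<^sub>+\<^sub>1(K)\<close>
  for large \<open>n\<close>, which contradicts lacunarity. Hence \<open>G(K) \<subseteq> A\<^sub>K\<close>, and \<open>A\<^sub>K\<close> is closed.

  Conversely let \<open>T \<in> A\<^sub>K\<close>. Given finitely many functionals \<open>f\<close> and independent vectors \<open>b \<in> V\<close>, choose as
  many independent vectors \<open>h\<close> in \<open>Y\<close> that are annihilated by all \<open>f\<close>; this is possible as \<open>Y\<close> is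
  infinite-dimensional. A finite-rank perturbation \<open>U\<close> of the identity swaps approximants in \<open>Y\<close> of the \<open>b\<close>
  with the \<open>h\<close>, in such a way that \<open>U\<^sup>2 = 1\<close> and \<open>f (U b) = 0\<close>. A finite-rank operator \<open>Z\<close> with range in
  \<open>Y\<close>, \<open>Z U Z = 0\<close> and \<open>f (Z b) = f (T b)\<close> is added to a large multiple of \<open>U\<close>. Then
  \<open>D = R U + Z\<close> satisfies \<open>f (D b) = f (T b)\<close>, and its inverse \<open>(U - U Z U / R) / R\<close> maps \<open>K\<close> into itself
  for large \<open>R\<close>.
\<close>

section \<open>Hahn-Banach theorem over the real or complex field\<close>

definition sublinear :: "('a::real_vector \<Rightarrow> real) \<Rightarrow> bool" where
  "sublinear p \<longleftrightarrow> (\<forall>x y. p (x + y) \<le> p x + p y) \<and> (\<forall>c x. 0 \<le> c \<longrightarrow> p (c *\<^sub>R x) = c * p x)"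

lemma sublinear_add: "sublinear p \<Longrightarrow> p (x + y) \<le> p x + p y"
  by (simp add: sublinear_def)

lemma sublinear_scale: "sublinear p \<Longrightarrow> 0 \<le> c \<Longrightarrow> p (c *\<^sub>R x) = c * p x"
  by (simp add: sublinear_def)

lemma sublinear_zero: "sublinear p \<Longrightarrow> p 0 = 0"
  using sublinear_scale[of p 0 0] by simp

lemma sublinear_minus: "sublinear p \<Longrightarrow> - p (- x) \<le> p x"
  using sublinear_add[of p x "- x"] sublinear_zero[of p] by simp

lemma sublinearI:
  assumes add: "\<And>x y. p (x + y) \<le> p x + p y"
    and scale: "\<And>c x. 0 < c \<Longrightarrow> p (c *\<^sub>R x) \<le> c * p x"
    and zero: "p 0 = 0"
  shows "sublinear p"
  unfolding sublinear_def
proof (intro conjI allI impI add)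
  fix c :: real and x assume "0 \<le> c"
  show "p (c *\<^sub>R x) = c * p x"
  proof (cases "c = 0")
    case False
    with \<open>0 \<le> c\<close> have c: "0 < c" by simp
    have "p ((1 / c) *\<^sub>R (c *\<^sub>R x)) \<le> (1 / c) * p (c *\<^sub>R x)"
      using c by (intro scale) simp
    then have "c * p x \<le> p (c *\<^sub>R x)"
      using c by (simp add: field_simps)
    with scale[OF c, of x] show ?thesis by simp
  qed (simp add: zero)
qed

text \<open>A sublinear functional that is minimal for the pointwise order is additive: otherwise
  \<open>x \<mapsto> inf\<^sub>t (p (x + t y) - t p(y))\<close> would be smaller.\<close>

lemma sublinear_decrease:
  fixes p :: "'a::real_vector \<Rightarrow> real"
  assumes p: "sublinear p"
  obtains q where "sublinear q" "\<And>x. q x \<le> p x" "\<And>x. q x \<le> p (x + y) - p y"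
proof -
  define q where "q x = (INF t\<in>{0..}. p (x + t *\<^sub>R y) - t * p y)" for x
  \<comment> \<open>This bound does not depend on \<open>t\<close>, so the infimum defining
    \<open>q\<close> is finite.\<close>
  have lower: "- p (- x) \<le> p (x + t *\<^sub>R y) - t * p y" if "0 \<le> t" for x t
    using sublinear_add[OF p, of "x + t *\<^sub>R y" "- x"] sublinear_scale[OF p that, of y] by simp
  have bdd: "bdd_below ((\<lambda>t. p (x + t *\<^sub>R y) - t * p y) ` {0..})" for x
    using lower by (intro bdd_belowI2) auto
  have q_le: "q x \<le> p (x + t *\<^sub>R y) - t * p y" if "0 \<le> t" for x t
    unfolding q_def using that by (intro cINF_lower bdd) auto
  have q_ge: "c \<le> q x" if "\<And>t. 0 \<le> t \<Longrightarrow> c \<le> p (x + t *\<^sub>R y) - t * p y" for c x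
    unfolding q_def using that by (intro cINF_greatest) auto
  have "sublinear q"
  proof (rule sublinearI)
    fix x x'
    have *: "q (x + x') \<le> (p (x + s *\<^sub>R y) - s * p y) + (p (x' + t *\<^sub>R y) - t * p y)"
      if "0 \<le> s" "0 \<le> t" for s t
      using q_le[of "s + t" "x + x'"] that sublinear_add[OF p, of "x + s *\<^sub>R y" "x' + t *\<^sub>R y"]
      by (simp add: algebra_simps)
    \<comment> \<open>The two infima are taken one after the other: over \<open>t\<close> with
      \<open>s\<close> fixed, then over \<open>s\<close>. The parameter \<open>s + t\<close> serves
      for the sum.\<close>
    have "q (x + x') - (p (x + s *\<^sub>R y) - s * p y) \<le> q x'" if "0 \<le> s" for s
      using *[OF that] by (intro q_ge) (simp add: algebra_simps)
    then have "q (x + x') - q x' \<le> q x"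
      by (intro q_ge) (simp add: algebra_simps)
    then show "q (x + x') \<le> q x + q x'" by simp
  next
    fix c :: real and x :: 'a assume c: "0 < c"
    have "q (c *\<^sub>R x) / c \<le> q x"
    proof (rule q_ge)
      fix t :: real assume t: "0 \<le> t"
      have "p (c *\<^sub>R x + (c * t) *\<^sub>R y) = c * p (x + t *\<^sub>R y)"
        using sublinear_scale[OF p, of c "x + t *\<^sub>R y"] c by (simp add: scaleR_add_right)
      with q_le[of "c * t" "c *\<^sub>R x"] c t
      show "q (c *\<^sub>R x) / c \<le> p (x + t *\<^sub>R y) - t * p y"
        by (simp add: field_simps)
    qed
    then show "q (c *\<^sub>R x) \<le> c * q x" using c by (simp add: field_simps)
  next
    show "q 0 = 0"
      using q_le[of 0 0] q_ge[of 0 0] sublinear_scale[OF p] sublinear_zero[OF p] by fastforce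
  qed
  moreover have "q x \<le> p x" for x using q_le[of 0 x] by simp
  moreover have "q x \<le> p (x + y) - p y" for x using q_le[of 1 x] by simp
  ultimately show thesis using that by blast
qed

lemma minimal_sublinear_linear:
  assumes p: "sublinear p"
    and min: "\<And>q. sublinear q \<Longrightarrow> (\<And>x. q x \<le> p x) \<Longrightarrow> q = p"
  shows "linear p"
proof -
  have add: "p (x + y) = p x + p y" for x y
  proof -
    obtain q where q: "sublinear q" "\<And>x. q x \<le> p x" "\<And>x. q x \<le> p (x + y) - p y"
      using sublinear_decrease[OF p] by blast
    have "p x \<le> p (x + y) - p y" using q(3)[of x] min[OF q(1,2)] by simp
    with sublinear_add[OF p, of x y] show ?thesis by simp
  qed
  have minus: "p (- x) = - p x" for x
    using add[of x "- x"] sublinear_zero[OF p] by simp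
  show ?thesis
  proof (rule linearI[OF add])
    fix c :: real and x
    show "p (c *\<^sub>R x) = c *\<^sub>R p x"
    proof (cases "0 \<le> c")
      case False
      then have "p ((- c) *\<^sub>R x) = (- c) * p x" by (intro sublinear_scale[OF p]) simp
      with minus[of "c *\<^sub>R x"] show ?thesis by simp
    qed (simp add: sublinear_scale[OF p])
  qed
qed

text \<open>The pointwise infimum works; it is finite because every member of \<open>C\<close> is at
  least \<open>- p (- x)\<close> at \<open>x\<close>. The chain condition gives subadditivity: of
  two members the smaller one can stand for both.\<close>

lemma sublinear_chain_lower_bound:
  fixes C :: "('a::real_vector \<Rightarrow> real) set"
  assumes ne: "C \<noteq> {}"
    and C: "\<And>q. q \<in> C \<Longrightarrow> sublinear q \<and> q \<le> p"
    and chain: "\<And>q r. q \<in> C \<Longrightarrow> r \<in> C \<Longrightarrow> q \<le> r \<or> r \<le> q"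
  obtains u where "sublinear u" "\<And>q. q \<in> C \<Longrightarrow> u \<le> q"
proof -
  define u where "u x = (INF q\<in>C. q x)" for x
  have bdd: "bdd_below ((\<lambda>q. q x) ` C)" for x
  proof (rule bdd_belowI2)
    fix q assume "q \<in> C"
    then show "- p (- x) \<le> q x"
      using sublinear_minus[of q x] C[of q] le_funD[of q p "- x"] by auto
  qed
  have u_le: "u x \<le> q x" if "q \<in> C" for q x
    unfolding u_def using that by (intro cINF_lower bdd)
  have u_ge: "c \<le> u x" if "\<And>q. q \<in> C \<Longrightarrow> c \<le> q x" for c x
    unfolding u_def using that ne by (intro cINF_greatest)
  have "sublinear u"
  proof (rule sublinearI)
    fix x y
    have *: "u (x + y) \<le> q x + r y" if "q \<in> C" "r \<in> C" for q r
    proof -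
      obtain s where s: "s \<in> C" "s \<le> q" "s \<le> r" using chain[of q r] \<open>q \<in> C\<close> \<open>r \<in> C\<close> by blast
      have "u (x + y) \<le> s x + s y"
        using u_le[OF s(1), of "x + y"] sublinear_add[of s x y] C[OF s(1)] by linarith
      with s(2,3) show ?thesis by (meson add_mono le_funD order_trans)
    qed
    have "u (x + y) - q x \<le> u y" if "q \<in> C" for q
      using *[OF that] by (intro u_ge) (simp add: algebra_simps)
    then have "u (x + y) - u y \<le> u x"
      by (intro u_ge) (simp add: algebra_simps)
    then show "u (x + y) \<le> u x + u y" by simp
  next
    fix c :: real and x assume c: "0 < c"
    have "u (c *\<^sub>R x) / c \<le> u x"
    proof (rule u_ge)
      fix q assume "q \<in> C"
      with u_le[OF this, of "c *\<^sub>R x"] C[OF this] c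
      show "u (c *\<^sub>R x) / c \<le> q x" by (simp add: sublinear_scale field_simps)
    qed
    then show "u (c *\<^sub>R x) \<le> c * u x" using c by (simp add: field_simps)
  next
    have "(\<lambda>q. q 0) ` C = {0}" using ne C sublinear_zero by force
    then show "u 0 = 0" by (simp add: u_def)
  qed
  then show thesis using that u_le by (simp add: le_fun_def)
qed

text \<open>Zorn's lemma is applied below a \<open>q\<close> that was first decreased in the
  direction \<open>z\<close>. Then \<open>q (- z) \<le> - p z\<close>, so every linear functional
  below \<open>q\<close> already attains \<open>p z\<close> at \<open>z\<close>.\<close>

theorem hahn_banach_sublinear:
  fixes p :: "'a::real_vector \<Rightarrow> real"
  assumes p: "sublinear p"
  obtains u where "linear u" "\<And>x. u x \<le> p x" "u z = p z"
proof -
  obtain q where q: "sublinear q" "\<And>x. q x \<le> p x" "\<And>x. q x \<le> p (x + z) - p z"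
    using sublinear_decrease[OF p] by blast
  define A where "A = {r. sublinear r \<and> r \<le> q}"
  have "\<exists>m\<in>A. \<forall>a\<in>A. a \<le> m \<longrightarrow> a = m"
  \<comment> \<open>The order is reversed, so that a maximal element is a minimal sublinear
    functional.\<close>
  proof (rule predicate_Zorn)
    show "partial_order_on A (relation_of (\<lambda>f g. g \<le> f) A)"
      by (rule partial_order_on_relation_ofI) auto
  next
    fix C assume "C \<in> Chains (relation_of (\<lambda>f g. g \<le> f) A)"
    then have C: "C \<subseteq> A" "\<And>f g. f \<in> C \<Longrightarrow> g \<in> C \<Longrightarrow> f \<le> g \<or> g \<le> f"
      by (auto simp: Chains_def relation_of_def)
    show "\<exists>u\<in>A. \<forall>a\<in>C. u \<le> a"
    proof (cases "C = {}")
      case True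
      with q(1) show ?thesis by (auto simp: A_def)
    next
      case False
      have "sublinear r \<and> r \<le> q" if "r \<in> C" for r
        using C(1) that by (auto simp: A_def)
      then obtain u where u: "sublinear u" "\<And>a. a \<in> C \<Longrightarrow> u \<le> a"
        using sublinear_chain_lower_bound[OF False _ C(2)] by metis
      obtain r where "r \<in> C" using False by blast
      then have "u \<le> q" using C(1) u(2)[of r] order_trans[of u r q] by (auto simp: A_def)
      with u show ?thesis by (auto simp: A_def)
    qed
  qed
  then obtain m where mA: "m \<in> A" and mmin: "\<And>a. a \<in> A \<Longrightarrow> a \<le> m \<Longrightarrow> a = m" by blast
  have m: "sublinear m" "m \<le> q" using mA by (auto simp: A_def)
  have m_eq: "a = m" if "sublinear a" "a \<le> m" for a
    using mmin[of a] that order_trans[OF that(2) m(2)] by (simp add: A_def)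
  have lin: "linear m"
    using m_eq by (intro minimal_sublinear_linear m) (auto simp: le_fun_def)
  have le: "m x \<le> p x" for x using m(2) q(2)[of x] by (meson le_funD order_trans)
  have "m (- z) \<le> p (- z + z) - p z" using m(2) q(3)[of "- z"] by (meson le_funD order_trans)
  then have "p z \<le> m z" using sublinear_zero[OF p] by (simp add: linear_neg[OF lin])
  with le[of z] show thesis using that[OF lin le] by simp
qed

section \<open>Real or complex scalars, and separation of a point from a closed subspace\<close>

lemma real_or_complex_cases:
  obtains (real) "\<And>c::'k::real_or_complex. \<exists>a. c = of_real a"
  | (complex) i :: "'k::real_or_complex"
    where "i * i = - 1" "\<And>c::'k. \<exists>a b. c = of_real a + i * of_real b"
proof -
  obtain h :: "'k \<Rightarrow> complex" where h: "\<And>a b. h (a + b) = h a + h b"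
    "\<And>a b. h (a * b) = h a * h b" "\<And>r. h (r *\<^sub>R 1) = of_real r"
    "\<And>a. cmod (h a) = norm a" "range h = \<real> \<or> range h = UNIV"
    using isometric_to_real_or_complex[where ?'a='k] by blast
  have h0: "h 0 = 0" using h(4)[of 0] by simp
  have hr: "h (of_real r) = of_real r" for r using h(3) by (simp add: of_real_def)
  \<comment> \<open>Additive and isometric, \<open>h\<close> is injective; equations between scalars
    can thus be checked in the complex numbers.\<close>
  have inj: "a = b" if "h a = h b" for a b
  proof -
    have "h a = h (a - b) + h b" using h(1)[of "a - b" b] by simp
    then have "norm (a - b) = 0" using that h(4)[of "a - b"] by simp
    then show ?thesis by simp
  qed
  show thesis
    using h(5)
  proof
    assume "range h = \<real>"
    then have "\<exists>a. c = of_real a" for c :: 'k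
    proof -
      have "h c \<in> \<real>" using \<open>range h = \<real>\<close> by blast
      then obtain r where "h c = of_real r" by (auto elim: Reals_cases)
      with inj hr show ?thesis by metis
    qed
    then show thesis by (rule real)
  next
    assume r: "range h = UNIV"
    then obtain i where i: "h i = \<i>" by (metis rangeE UNIV_I)
    have "h (- 1) = - 1" using hr[of "- 1"] by simp
    then have ii: "i * i = - 1" using i h(2)[of i i] by (intro inj) simp
    have "c = of_real (Re (h c)) + i * of_real (Im (h c))" for c
      by (rule inj) (simp add: h(1,2) hr i complex_eq)
    with ii show thesis by (intro complex) blast+
  qed
qed

context banach_space_over
begin

lemma smul_scaleR: "smul (r *\<^sub>R c) x = r *\<^sub>R smul c x"
proof -
  have "smul (r *\<^sub>R c) x = smul (of_real r) (smul c x)"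
    by (simp only: scale_scale scaleR_conv_of_real)
  then show ?thesis by (simp only: scale_of_real)
qed

lemma scaleR_smul: "smul c (r *\<^sub>R x) = r *\<^sub>R smul c x"
  by (metis scale_left_commute scale_of_real)

lemma bounded_linear_smul_right: "bounded_linear (smul c)"
  by (rule bounded_linear_intro[where K = "norm c"])
    (simp_all add: scale_right_distrib scaleR_smul norm_scale mult.commute)

lemma bounded_linear_smul_left: "bounded_linear (\<lambda>c. smul c x)"
  by (rule bounded_linear_intro[where K = "norm x"])
    (simp_all add: scale_left_distrib smul_scaleR norm_scale)

lemma subspace_scaleR: "subspace V \<Longrightarrow> x \<in> V \<Longrightarrow> r *\<^sub>R x \<in> V"
  by (metis scale_of_real subspace_scale)

lemma dual_linear: "g \<in> dual_space smul \<Longrightarrow> bounded_linear g"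
  and dual_scale: "g \<in> dual_space smul \<Longrightarrow> g (smul c x) = c * g x"
  and op_linear: "T \<in> bounded_operators smul \<Longrightarrow> bounded_linear T"
  and op_scale: "T \<in> bounded_operators smul \<Longrightarrow> T (smul c x) = smul c (T x)"
  by (simp_all add: dual_space_def bounded_operators_def)

text \<open>The distance to \<open>V\<close> is the majorant for the separation theorem: a linear
  functional below it vanishes on \<open>V\<close> and has norm at most 1.\<close>

lemma sublinear_infdist:
  assumes V: "subspace V"
  shows "sublinear (\<lambda>x. infdist x V)"
proof (rule sublinearI)
  have ne: "V \<noteq> {}" using subspace_0[OF V] by blast
  have approx: "\<exists>v\<in>V. norm (x - v) < infdist x V + e" if "0 < e" for x and e :: real
  proof -
    have "\<exists>y\<in>dist x ` V. y < Inf (dist x ` V) + e"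
      using ne that by (subst cInf_less_iff[symmetric]) auto
    then show ?thesis using infdist_notempty[OF ne, of x] by (auto simp: dist_norm)
  qed
  fix x y
  show "infdist (x + y) V \<le> infdist x V + infdist y V"
  proof (rule field_le_epsilon)
    fix e :: real assume "0 < e"
    then obtain v w where v: "v \<in> V" "norm (x - v) < infdist x V + e / 2"
      and w: "w \<in> V" "norm (y - w) < infdist y V + e / 2"
      using approx[of "e / 2"] by (metis half_gt_zero)
    have "infdist (x + y) V \<le> norm ((x - v) + (y - w))"
      using infdist_le[OF subspace_add[OF V v(1) w(1)], of "x + y"]
      by (simp add: dist_norm algebra_simps)
    with norm_triangle_ineq[of "x - v" "y - w"] v(2) w(2)
    show "infdist (x + y) V \<le> infdist x V + infdist y V + e" by linarith
  qed
next
  fix c :: real and x assume c: "0 < c"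
  have "infdist (c *\<^sub>R x) V / c \<le> dist x v" if "v \<in> V" for v
  proof -
    have "infdist (c *\<^sub>R x) V \<le> norm (c *\<^sub>R x - c *\<^sub>R v)"
      using infdist_le[OF subspace_scaleR[OF V that], of "c *\<^sub>R x" c] by (simp add: dist_norm)
    also have "\<dots> = c * dist x v"
      using c by (simp add: dist_norm flip: scaleR_diff_right)
    finally show ?thesis using c by (simp add: field_simps)
  qed
  then have "infdist (c *\<^sub>R x) V / c \<le> infdist x V"
    using subspace_0[OF V] by (subst infdist_notempty) (auto intro!: cINF_greatest)
  then show "infdist (c *\<^sub>R x) V \<le> c * infdist x V" using c by (simp add: field_simps)
next
  show "infdist 0 V = 0" using subspace_0[OF V] by simp
qed

text \<open>A real functional \<open>u\<close> below the distance to \<open>V\<close> and equal to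
  it at \<open>z\<close> is nonzero at \<open>z\<close>, since \<open>V\<close> is closed. It is
  then made linear over the scalar field and normalised.\<close>

theorem hahn_banach_separation:
  assumes V: "subspace V" "closed V" and z: "z \<notin> V"
  obtains g where "g \<in> dual_space smul" "\<And>x. x \<in> V \<Longrightarrow> g x = 0" "g z = 1"
proof -
  obtain u where u: "linear u" "\<And>x. u x \<le> infdist x V" "u z = infdist z V"
    using hahn_banach_sublinear[OF sublinear_infdist[OF V(1)]] by blast
  have uz: "u z \<noteq> 0"
    using u(3) z V subspace_0[OF V(1)] in_closed_iff_infdist_zero[OF V(2)] by auto
  have u_norm: "\<bar>u x\<bar> \<le> norm x" for x
  proof -
    have "infdist y V \<le> norm y" for y
      using infdist_le[OF subspace_0[OF V(1)], of y] by (simp add: dist_norm)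
    from this[of x] this[of "- x"] u(2)[of x] u(2)[of "- x"] show ?thesis
      by (simp add: linear_neg[OF u(1)] abs_le_iff)
  qed
  have bu: "bounded_linear u"
    using u(1) u_norm
    by (intro bounded_linear_intro[where K = 1]) (simp_all add: linear_add linear_cmul)
  have u_V: "u x = 0" if "x \<in> V" for x
    using u(2)[of x] u(2)[of "- x"] that subspace_neg[OF V(1) that]
    by (simp add: linear_neg[OF u(1)])
  have "\<exists>f\<in>dual_space smul. (\<forall>x\<in>V. f x = 0) \<and> f z \<noteq> 0"
  proof (cases rule: real_or_complex_cases[where ?'k='k])
    case real
    define f :: "'a \<Rightarrow> 'k" where "f x = of_real (u x)" for x
    have "bounded_linear f"
      unfolding f_def by (rule bounded_linear_compose[OF bounded_linear_of_real bu])
    moreover have "f (smul c x) = c * f x" for c x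
    proof -
      obtain a where "c = of_real a" using real by blast
      then show ?thesis by (simp add: f_def scale_of_real linear_cmul[OF u(1)])
    qed
    ultimately show ?thesis using u_V uz by (force simp: f_def dual_space_def)
  next
    case (complex i)
    \<comment> \<open>The usual complexification of a real functional; it vanishes on
      \<open>V\<close> because \<open>V\<close> is invariant under multiplication by
      \<open>i\<close>.\<close>
    define f :: "'a \<Rightarrow> 'k" where "f x = of_real (u x) - i * of_real (u (smul i x))" for x
    have bui: "bounded_linear (\<lambda>x. u (smul i x))"
      by (rule bounded_linear_compose[OF bu bounded_linear_smul_right])
    have bf: "bounded_linear f"
      unfolding f_def
      by (intro bounded_linear_sub bounded_linear_const_mult
          bounded_linear_compose[OF bounded_linear_of_real] bu bui)
    interpret f: bounded_linear f by (rule bf)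
    have fi: "f (smul i x) = i * f x" for x
      using complex(1)
      by (simp add: f_def linear_neg[OF u(1)] algebra_simps flip: mult.assoc)
    have fr: "f (smul (of_real a) x) = of_real a * f x" for a x
      by (simp only: scale_of_real f.scaleR scaleR_conv_of_real)
    have "f (smul c x) = c * f x" for c x
    proof -
      obtain a b where "c = of_real a + i * of_real b" using complex(2) by blast
      then show ?thesis
        by (simp add: scale_left_distrib f.add fr fi distrib_right mult.assoc flip: scale_scale)
    qed
    moreover have "f x = 0" if "x \<in> V" for x
      using u_V subspace_scale[OF V(1) that] that by (simp add: f_def)
    moreover have "f z \<noteq> 0"
    proof
      assume "f z = 0"
      then have e: "of_real (u z) = i * of_real (u (smul i z))" by (simp add: f_def)
      define a b where "a = u z" and "b = u (smul i z)"
      \<comment> \<open>Squaring turns \<open>a = i * b\<close> into an equation between reals,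
        which forces \<open>a = 0\<close>.\<close>
      have "(of_real (a * a) :: 'k) = (i * i) * (of_real b * of_real b)"
        using e by (simp add: a_def b_def)
      also have "\<dots> = of_real (- (b * b))" using complex(1) by simp
      finally have "a * a = - (b * b)" by (simp only: of_real_eq_iff)
      then have "a = 0" by (smt (verit) zero_less_mult_iff mult_eq_0_iff zero_le_square)
      with uz show False by (simp add: a_def)
    qed
    ultimately show ?thesis using bf by (auto simp: dual_space_def)
  qed
  then obtain f where f: "f \<in> dual_space smul" "\<And>x. x \<in> V \<Longrightarrow> f x = 0" "f z \<noteq> 0" by blast
  define g where "g x = inverse (f z) * f x" for x
  have "g \<in> dual_space smul"
    using dual_linear[OF f(1)] dual_scale[OF f(1)]
    by (auto simp: dual_space_def g_def[abs_def] intro: bounded_linear_const_mult)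
  then show thesis using that[of g] f by (simp add: g_def)
qed

end

section \<open>Bounded operators and functionals\<close>

context banach_space_over
begin

lemma op_id: "(\<lambda>x. x) \<in> bounded_operators smul"
  by (simp add: bounded_operators_def)

lemma op_add: "S \<in> bounded_operators smul \<Longrightarrow> T \<in> bounded_operators smul \<Longrightarrow>
    (\<lambda>x. S x + T x) \<in> bounded_operators smul"
  by (simp add: bounded_operators_def bounded_linear_add scale_right_distrib)

lemma op_diff: "S \<in> bounded_operators smul \<Longrightarrow> T \<in> bounded_operators smul \<Longrightarrow>
    (\<lambda>x. S x - T x) \<in> bounded_operators smul"
  by (simp add: bounded_operators_def bounded_linear_sub scale_right_diff_distrib)

lemma op_compose: "S \<in> bounded_operators smul \<Longrightarrow> T \<in> bounded_operators smul \<Longrightarrow>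
    (\<lambda>x. S (T x)) \<in> bounded_operators smul"
  by (simp add: bounded_operators_def bounded_linear_compose)

lemma op_scaleR: "T \<in> bounded_operators smul \<Longrightarrow> (\<lambda>x. r *\<^sub>R T x) \<in> bounded_operators smul"
  by (simp add: bounded_operators_def scaleR_smul
      bounded_linear_compose[OF bounded_linear_scaleR_right])

lemma op_rank_one: "g \<in> dual_space smul \<Longrightarrow> (\<lambda>x. smul (g x) y) \<in> bounded_operators smul"
  by (simp add: bounded_operators_def dual_space_def
      bounded_linear_compose[OF bounded_linear_smul_left])

lemma op_sum: "(\<And>i. i \<in> I \<Longrightarrow> T i \<in> bounded_operators smul) \<Longrightarrow>
    (\<lambda>x. \<Sum>i\<in>I. T i x) \<in> bounded_operators smul"
  by (simp add: bounded_operators_def bounded_linear_sum scale_sum_right)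

lemma dual_diff: "f \<in> dual_space smul \<Longrightarrow> g \<in> dual_space smul \<Longrightarrow>
    (\<lambda>x. f x - g x) \<in> dual_space smul"
  by (simp add: dual_space_def bounded_linear_sub right_diff_distrib)

lemma dual_compose: "f \<in> dual_space smul \<Longrightarrow> T \<in> bounded_operators smul \<Longrightarrow>
    (\<lambda>x. f (T x)) \<in> dual_space smul"
  by (simp add: dual_space_def bounded_operators_def bounded_linear_compose)

lemma op_zero_simp: "T \<in> bounded_operators smul \<Longrightarrow> T 0 = 0"
  and op_add_simp: "T \<in> bounded_operators smul \<Longrightarrow> T (x + y) = T x + T y"
  and op_diff_simp: "T \<in> bounded_operators smul \<Longrightarrow> T (x - y) = T x - T y"
  and op_scaleR_simp: "T \<in> bounded_operators smul \<Longrightarrow> T (r *\<^sub>R x) = r *\<^sub>R T x"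
  and op_sum_simp: "T \<in> bounded_operators smul \<Longrightarrow> T (sum h I) = (\<Sum>i\<in>I. T (h i))"
  by (auto dest!: op_linear simp: linear_simps bounded_linear.linear linear_sum linear_0)

lemma dual_zero_simp: "f \<in> dual_space smul \<Longrightarrow> f 0 = 0"
  and dual_add_simp: "f \<in> dual_space smul \<Longrightarrow> f (x + y) = f x + f y"
  and dual_diff_simp: "f \<in> dual_space smul \<Longrightarrow> f (x - y) = f x - f y"
  and dual_scaleR_simp: "f \<in> dual_space smul \<Longrightarrow> f (r *\<^sub>R x) = r *\<^sub>R f x"
  and dual_sum_simp: "f \<in> dual_space smul \<Longrightarrow> f (sum h I) = (\<Sum>i\<in>I. f (h i))"
  by (auto dest!: dual_linear simp: linear_simps bounded_linear.linear linear_sum linear_0)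

lemmas op_simps = op_zero_simp op_add_simp op_diff_simp op_scaleR_simp op_sum_simp op_scale
lemmas dual_simps = dual_zero_simp dual_add_simp dual_diff_simp dual_scaleR_simp dual_sum_simp
  dual_scale

lemma op_continuous: "T \<in> bounded_operators smul \<Longrightarrow> continuous_on S T"
  by (simp add: bounded_operators_def linear_continuous_on)

lemma op_image_closure: "T \<in> bounded_operators smul \<Longrightarrow> T ` S \<subseteq> W \<Longrightarrow> T ` closure S \<subseteq> closure W"
  by (meson closed_closure closure_subset image_closure_subset op_continuous subset_trans)

lemma op_vector_space_linear: "T \<in> bounded_operators smul \<Longrightarrow> Vector_Spaces.linear smul smul T"
  by unfold_locales (simp_all add: op_simps)

lemma op_image_span: "T \<in> bounded_operators smul \<Longrightarrow> T ` span S = span (T ` S)"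
proof -
  assume "T \<in> bounded_operators smul"
  then interpret T: Vector_Spaces.linear smul smul T by (rule op_vector_space_linear)
  show ?thesis by (simp add: T.span_image)
qed

section \<open>Closed subspaces, biorthogonal systems and finitely many functionals\<close>

lemma subspace_kernel_Int:
  assumes "\<Phi> \<subseteq> dual_space smul" "subspace Y"
  shows "subspace (Y \<inter> {x. \<forall>\<phi>\<in>\<Phi>. \<phi> x = 0})"
  using assms by (auto simp: subspace_def subset_iff dual_simps)

lemma subspace_closure: "subspace Y \<Longrightarrow> subspace (closure Y)"
proof (rule subspaceI)
  assume Y: "subspace Y"
  show "0 \<in> closure Y" using subspace_0[OF Y] closure_subset by blast
  show "x + y \<in> closure Y" if xy: "x \<in> closure Y" "y \<in> closure Y" for x y
  proof -
    obtain f g where "\<forall>n. f n \<in> Y" "f \<longlonglongrightarrow> x" "\<forall>n. g n \<in> Y" "g \<longlonglongrightarrow> y"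
      using xy unfolding closure_sequential by blast
    then show ?thesis
      unfolding closure_sequential
      by (intro exI[of _ "\<lambda>n. f n + g n"]) (auto intro: tendsto_add subspace_add[OF Y])
  qed
  show "smul c x \<in> closure Y" if "x \<in> closure Y" for c x
  proof -
    have "smul c ` closure Y \<subseteq> closure Y"
      using subspace_scale[OF Y] closure_subset
      by (intro image_closure_subset linear_continuous_on bounded_linear_smul_right) auto
    with that show ?thesis by blast
  qed
qed

text \<open>For \<open>b\<close> outside \<open>V\<close>, the continuous map \<open>L\<close>
  projects the span onto \<open>V\<close> along \<open>b\<close>. It therefore maps the closure of
  the span into \<open>V\<close>, and \<open>x\<close> differs from \<open>L x\<close> only by a
  multiple of \<open>b\<close>.\<close>

lemma closed_span_insert:
  assumes V: "subspace V" "closed V"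
  shows "closed (span (insert b V))"
proof (cases "b \<in> V")
  case True
  with V show ?thesis by (simp add: insert_absorb span_eq_iff[THEN iffD2])
next
  case False
  then obtain g where g: "g \<in> dual_space smul" "\<And>x. x \<in> V \<Longrightarrow> g x = 0" "g b = 1"
    using hahn_banach_separation[OF V] by blast
  define L where "L x = x - smul (g x) b" for x
  have L: "L \<in> bounded_operators smul"
    unfolding L_def by (intro op_diff op_id op_rank_one g)
  have "L x \<in> V" if x: "x \<in> span (insert b V)" for x
  proof -
    obtain k where k: "x - smul k b \<in> V"
      using x span_eq_iff[THEN iffD2, OF V(1)] by (auto simp: span_insert)
    have "g x = k" using g(2)[OF k] by (simp add: dual_simps[OF g(1)] g(3))
    with k show ?thesis by (simp add: L_def)
  qed
  then have "L ` closure (span (insert b V)) \<subseteq> closure V"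
    by (intro op_image_closure L) blast
  then have "x \<in> span (insert b V)" if "x \<in> closure (span (insert b V))" for x
  proof -
    have "L x \<in> V" using \<open>L ` _ \<subseteq> _\<close> that V(2) by auto
    then show ?thesis by (auto simp: span_insert L_def intro: span_base)
  qed
  then show ?thesis by (metis closure_subset closure_eq subsetI subset_antisym)
qed

lemma closed_span_finite:
  assumes "finite B"
  shows "closed (span B)"
  using assms
proof induction
  case (insert b B)
  have "span (insert b B) = span (insert b (span B))" by (simp add: span_insert span_span)
  with insert.IH show ?case by (simp add: closed_span_insert subspace_span)
qed simp

text \<open>Each \<open>b\<close> is separated from the span of the other vectors, which is closed
  because it is finite-dimensional.\<close>

lemma biorthogonal_functionals:
  assumes "finite B" "independent B"
  obtains G where "\<And>b. b \<in> B \<Longrightarrow> G b \<in> dual_space smul"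
    "\<And>b c. b \<in> B \<Longrightarrow> c \<in> B \<Longrightarrow> G b c = (if b = c then 1 else 0)"
proof -
  have "\<exists>g\<in>dual_space smul. \<forall>c\<in>B. g c = (if b = c then 1 else 0)" if "b \<in> B" for b
  proof -
    have "b \<notin> span (B - {b})" using assms(2) that by (auto simp: dependent_def)
    then obtain g where "g \<in> dual_space smul" "\<And>x. x \<in> span (B - {b}) \<Longrightarrow> g x = 0" "g b = 1"
      using hahn_banach_separation[OF subspace_span closed_span_finite, of "B - {b}" b] assms(1)
      by blast
    then show ?thesis by (intro bexI[of _ g]) (auto intro: span_base)
  qed
  then have "\<forall>b\<in>B. \<exists>g. g \<in> dual_space smul \<and> (\<forall>c\<in>B. g c = (if b = c then 1 else 0))"
    by blast
  from bchoice[OF this] obtain G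
    where "\<forall>b\<in>B. G b \<in> dual_space smul \<and> (\<forall>c\<in>B. G b c = (if b = c then 1 else 0))" ..
  then show thesis by (intro that[of G]) auto
qed

text \<open>Induction on the functionals. If \<open>\<phi>\<close> vanishes on \<open>Y\<close>, it
  vanishes at \<open>x\<close> by continuity. Otherwise a \<open>y0\<close> in \<open>Y\<close> with
  \<open>\<phi> y0 = 1\<close> gives a projection \<open>L\<close> of \<open>Y\<close> onto the
  kernel of \<open>\<phi>\<close> in \<open>Y\<close>; the induction hypothesis is used there for
  \<open>L x\<close>, and a multiple of \<open>y0\<close> restores the value of
  \<open>\<phi>\<close>.\<close>

lemma exists_same_values:
  assumes "finite \<Phi>" "\<Phi> \<subseteq> dual_space smul" "subspace Y" "x \<in> closure Y"
  shows "\<exists>y\<in>Y. \<forall>\<phi>\<in>\<Phi>. \<phi> y = \<phi> x"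
  using assms
proof (induction arbitrary: Y x)
  case empty
  then show ?case using subspace_0 by blast
next
  case (insert \<phi> \<Phi>)
  have \<phi>: "\<phi> \<in> dual_space smul" using insert.prems by simp
  show ?case
  proof (cases "\<forall>y\<in>Y. \<phi> y = 0")
    case True
    then have "\<phi> x = 0"
      by (intro continuous_constant_on_closure[OF linear_continuous_on[OF dual_linear[OF \<phi>]] _
            insert.prems(3)]) blast
    with True insert.IH[OF _ insert.prems(2,3)] insert.prems(1) show ?thesis by auto
  next
    case False
    then obtain y1 where y1: "y1 \<in> Y" "\<phi> y1 \<noteq> 0" by blast
    define y0 where "y0 = smul (inverse (\<phi> y1)) y1"
    have y0: "y0 \<in> Y" "\<phi> y0 = 1"
      using y1 insert.prems(2) by (simp_all add: y0_def subspace_scale dual_scale[OF \<phi>])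
    define L where "L x = x - smul (\<phi> x) y0" for x
    have L: "L \<in> bounded_operators smul"
      unfolding L_def by (intro op_diff op_id op_rank_one \<phi>)
    define Y1 where "Y1 = Y \<inter> {x. \<forall>\<phi>\<in>{\<phi>}. \<phi> x = 0}"
    have Y1: "subspace Y1"
      unfolding Y1_def using \<phi> insert.prems(2) by (intro subspace_kernel_Int) auto
    have "L ` Y \<subseteq> Y1"
      using insert.prems(2) y0
      by (auto simp: L_def Y1_def dual_simps[OF \<phi>] intro!: subspace_diff subspace_scale)
    then have "L x \<in> closure Y1" using op_image_closure[OF L] insert.prems(3) by blast
    with insert.IH[OF _ Y1] insert.prems(1)
    obtain y where y: "y \<in> Y1" "\<forall>\<psi>\<in>\<Phi>. \<psi> y = \<psi> (L x)"
      by blast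
    show ?thesis
    proof (intro bexI ballI)
      show "y + smul (\<phi> x) y0 \<in> Y"
        using y y0 insert.prems(2) by (auto simp: Y1_def intro!: subspace_add subspace_scale)
      fix \<psi> assume "\<psi> \<in> insert \<phi> \<Phi>"
      then show "\<psi> (y + smul (\<phi> x) y0) = \<psi> x"
        using y y0 insert.prems(1) by (auto simp: dual_simps Y1_def L_def subset_iff)
    qed
  qed
qed

text \<open>Each functional lowers the dimension by at most one: one vector outside its kernel,
  together with the kernel, spans everything.\<close>

lemma infinite_dimensional_kernel:
  assumes "finite \<Phi>" "\<Phi> \<subseteq> dual_space smul"
    and "subspace Y" "\<And>A. finite A \<Longrightarrow> \<not> Y \<subseteq> span A" "finite A"
  shows "\<not> Y \<inter> {x. \<forall>\<phi>\<in>\<Phi>. \<phi> x = 0} \<subseteq> span A"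
  using assms
proof (induction arbitrary: A)
  case (insert \<phi> \<Phi>)
  define Y' where "Y' = Y \<inter> {x. \<forall>\<phi>\<in>\<Phi>. \<phi> x = 0}"
  have Y': "subspace Y'"
    using insert.prems by (auto simp: Y'_def intro!: subspace_kernel_Int)
  have \<phi>: "\<phi> \<in> dual_space smul" using insert.prems by simp
  have not_sub: "\<not> Y' \<subseteq> span A" if "finite A" for A
    using insert that by (auto simp: Y'_def)
  show ?case
  proof
    assume A: "Y \<inter> {x. \<forall>\<phi>\<in>insert \<phi> \<Phi>. \<phi> x = 0} \<subseteq> span A"
    obtain y where y: "y \<in> Y'" "\<phi> y \<noteq> 0"
      using A not_sub[of A] insert.prems(4) by (auto simp: Y'_def)
    have "x \<in> span (insert y A)" if "x \<in> Y'" for x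
    proof -
      have "x - smul (\<phi> x / \<phi> y) y \<in> Y'"
        using that y Y' by (auto intro!: subspace_diff subspace_scale)
      then have "x - smul (\<phi> x / \<phi> y) y \<in> span A"
        using A y by (auto simp: Y'_def dual_simps[OF \<phi>])
      then show ?thesis by (auto simp: span_insert)
    qed
    then show False using not_sub[of "insert y A"] insert.prems(4) by blast
  qed
qed simp

lemma extend_independent:
  assumes Y: "\<And>A. finite A \<Longrightarrow> \<not> Y \<subseteq> span A" and B: "finite B" "independent B"
  shows "\<exists>H\<subseteq>Y. finite H \<and> card H = n \<and> H \<inter> B = {} \<and> independent (B \<union> H)"
proof (induction n)
  case (Suc n)
  then obtain H where H: "H \<subseteq> Y" "finite H" "card H = n" "H \<inter> B = {}" "independent (B \<union> H)"
    by blast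
  obtain y where y: "y \<in> Y" "y \<notin> span (B \<union> H)" using Y[of "B \<union> H"] B H by auto
  then have "y \<notin> B \<union> H" by (auto intro: span_base)
  with H y show ?case
    by (intro exI[of _ "insert y H"]) (auto simp: independent_insert)
qed (use B in \<open>auto intro!: exI[of _ "{}"]\<close>)

text \<open>Serves to split each \<open>x\<close> in \<open>A\<close> into a part
  \<open>x - P x\<close> in \<open>V\<close> and a part \<open>P x\<close> that can be treated
  freely. The induction adds one vector \<open>b\<close> to \<open>V\<close> at a time.\<close>

lemma finite_rank_retraction_modulo:
  assumes "finite A" "subspace V" "closed V"
  shows "\<exists>P\<in>bounded_operators smul. (\<forall>x\<in>V. P x = 0) \<and> (\<forall>x\<in>A. x - P x \<in> V)"
  using assms
proof (induction arbitrary: V)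
  case empty
  then show ?case
    by (intro bexI[of _ "\<lambda>x. 0"]) (auto simp: bounded_operators_def)
next
  case (insert b A)
  show ?case
  proof (cases "b \<in> V")
    case True
    with insert.IH[OF insert.prems] show ?thesis by (metis diff_zero insert_iff)
  next
    case False
    obtain g where g: "g \<in> dual_space smul" "\<And>x. x \<in> V \<Longrightarrow> g x = 0" "g b = 1"
      using hahn_banach_separation[OF insert.prems False] by blast
    define W where "W = span (insert b V)"
    have "subspace W" "closed W"
      using closed_span_insert[OF insert.prems] by (auto simp: W_def)
    then obtain P where P: "P \<in> bounded_operators smul" "\<And>x. x \<in> W \<Longrightarrow> P x = 0"
      "\<And>x. x \<in> A \<Longrightarrow> x - P x \<in> W"
      using insert.IH by blast
    have W: "b \<in> W" "V \<subseteq> W" by (auto simp: W_def span_base)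
    \<comment> \<open>The remainder \<open>x - P x\<close> lies in \<open>W\<close> for
      \<open>x\<close> in \<open>A\<close>; \<open>g\<close> reads off its coefficient at
      \<open>b\<close>, and removing that component leaves a vector of \<open>V\<close>.\<close>
    define Q where "Q x = P x + smul (g (x - P x)) b" for x
    have "Q \<in> bounded_operators smul"
      unfolding Q_def by (intro op_add op_rank_one dual_compose[OF g(1)] op_diff op_id P(1))
    moreover have "Q x = 0" if "x \<in> V" for x
      using that W P(2) g(2) by (auto simp: Q_def)
    moreover have "y - smul (g y) b \<in> V" if y: "y \<in> W" for y
    proof -
      obtain k where k: "y - smul k b \<in> V"
        using y span_eq_iff[THEN iffD2, OF insert.prems(1)] by (auto simp: span_insert W_def)
      have "g y = k" using g(2)[OF k] by (simp add: dual_simps[OF g(1)] g(3))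
      with k show ?thesis by simp
    qed
    then have "x - Q x \<in> V" if "x - P x \<in> W" for x
      using that by (simp add: Q_def diff_diff_eq[symmetric])
    moreover have "b - P b \<in> W" using W P(2) by simp
    ultimately show ?thesis using P(3) by (intro bexI[of _ Q]) auto
  qed
qed

end

section \<open>Operators covering an absolutely convex set\<close>

lemma (in banach_space_over) G_ofI:
  assumes "D \<in> bounded_operators smul" "\<And>x. x \<in> K \<Longrightarrow> C x \<in> K" "\<And>x. x \<in> K \<Longrightarrow> D (C x) = x"
  shows "D \<in> G_of smul K"
  using assms by (force simp: G_of_def image_iff)

locale bounded_disc = banach_space_over smul
  for smul :: "'k::real_or_complex \<Rightarrow> 'a::banach \<Rightarrow> 'a" +
  fixes K :: "'a set"
  assumes absolutely_convex: "absolutely_convex smul K"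
    and nonempty: "K \<noteq> {}"
    and bounded: "bounded K"
begin

lemma smul_mem: "x \<in> K \<Longrightarrow> norm c \<le> 1 \<Longrightarrow> smul c x \<in> K"
  using absolutely_convex by (auto simp: absolutely_convex_def)

lemma scaleR_mem: "x \<in> K \<Longrightarrow> \<bar>r\<bar> \<le> 1 \<Longrightarrow> r *\<^sub>R x \<in> K"
  using smul_mem[of x "of_real r"] by (simp add: scale_of_real)

lemma uminus_mem: "x \<in> K \<Longrightarrow> - x \<in> K"
  using scaleR_mem[of x "- 1"] by simp

lemma zero_mem: "0 \<in> K"
  using nonempty scaleR_mem[of _ 0] by auto

lemma add_scaleR_mem:
  assumes "x \<in> K" "y \<in> K" "0 \<le> a" "0 \<le> b"
  shows "\<exists>z\<in>K. a *\<^sub>R x + b *\<^sub>R y = (a + b) *\<^sub>R z"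
proof (cases "a + b = 0")
  case True
  with assms(3,4) have "a = 0" "b = 0" by auto
  with assms(1) show ?thesis by auto
next
  case False
  have "convex K" using absolutely_convex by (simp add: absolutely_convex_def)
  then have "(a / (a + b)) *\<^sub>R x + (b / (a + b)) *\<^sub>R y \<in> K"
    using assms False by (intro convexD) (auto simp flip: add_divide_distrib)
  moreover have "a *\<^sub>R x + b *\<^sub>R y = (a + b) *\<^sub>R ((a / (a + b)) *\<^sub>R x + (b / (a + b)) *\<^sub>R y)"
    using False by (simp add: scaleR_add_right)
  ultimately show ?thesis by blast
qed

lemma smul_scaleR_mem:
  assumes "x \<in> K" "norm c \<le> m"
  shows "\<exists>y\<in>K. smul c x = m *\<^sub>R y"
proof (cases "m = 0")
  case True
  with assms show ?thesis by auto
next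
  case False
  with assms(2) have m: "0 < m" using norm_ge_zero[of c] by linarith
  have "smul ((1 / m) *\<^sub>R c) x \<in> K" using assms m by (intro smul_mem) auto
  moreover have "smul c x = m *\<^sub>R smul ((1 / m) *\<^sub>R c) x" using m by (simp add: smul_scaleR)
  ultimately show ?thesis by blast
qed

text \<open>The positive multiples of elements of \<open>K\<close> already form a subspace; in other
  words, the gauge of \<open>K\<close> is finite on its span.\<close>

lemma span_eq_scaled:
  assumes "x \<in> span K"
  shows "\<exists>c>0. \<exists>k\<in>K. x = c *\<^sub>R k"
proof -
  have "span K \<subseteq> {x. \<exists>c>0. \<exists>k\<in>K. x = c *\<^sub>R k}"
  proof (rule span_minimal)
    show "K \<subseteq> {x. \<exists>c>0. \<exists>k\<in>K. x = c *\<^sub>R k}" by (auto intro!: exI[of _ "1::real"])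
    show "subspace {x. \<exists>c>0. \<exists>k\<in>K. x = c *\<^sub>R k}"
    proof (rule subspaceI; clarsimp)
      show "\<exists>c>0. \<exists>k\<in>K. c = (0::real) \<or> k = 0" using zero_mem zero_less_one by blast
      fix a b :: real and x y assume "0 < a" "0 < b" "x \<in> K" "y \<in> K"
      then show "\<exists>c>0. \<exists>k\<in>K. a *\<^sub>R x + b *\<^sub>R y = c *\<^sub>R k"
        using add_scaleR_mem[of x y a b] by (intro exI[of _ "a + b"]) auto
    next
      fix c x and a :: real assume a: "0 < a" and x: "x \<in> K"
      \<comment> \<open>The summand 1 keeps the factor positive when \<open>c = 0\<close>.\<close>
      obtain y where "y \<in> K" "smul c x = (norm c + 1) *\<^sub>R y"
        using smul_scaleR_mem[OF x, of c "norm c + 1"] by auto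
      with a show "\<exists>b>0. \<exists>k\<in>K. smul c (a *\<^sub>R x) = b *\<^sub>R k"
        by (intro exI[of _ "a * (norm c + 1)"])
          (auto simp: scaleR_smul intro!: mult_pos_pos add_nonneg_pos)
    qed
  qed
  with assms show ?thesis by blast
qed

text \<open>Boundedness for the gauge of \<open>K\<close>, the norm on \<open>span K\<close> whose unit ball is \<open>K\<close>.\<close>

definition gauge_bounded :: "('a \<Rightarrow> 'a) \<Rightarrow> bool" where
  "gauge_bounded T \<longleftrightarrow> (\<exists>c>0. \<forall>x\<in>K. \<exists>y\<in>K. T x = c *\<^sub>R y)"

lemma gauge_bounded_id: "gauge_bounded (\<lambda>x. x)"
  unfolding gauge_bounded_def by (intro exI[of _ 1]) auto

lemma gauge_bounded_add:
  assumes "gauge_bounded S" "gauge_bounded T"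
  shows "gauge_bounded (\<lambda>x. S x + T x)"
proof -
  obtain a b where "0 < a" "\<And>x. x \<in> K \<Longrightarrow> \<exists>y\<in>K. S x = a *\<^sub>R y"
    "0 < b" "\<And>x. x \<in> K \<Longrightarrow> \<exists>y\<in>K. T x = b *\<^sub>R y"
    using assms unfolding gauge_bounded_def by blast
  then show ?thesis
    unfolding gauge_bounded_def using add_scaleR_mem[of _ _ a b]
    by (intro exI[of _ "a + b"]) (metis add_pos_pos less_imp_le)
qed

lemma gauge_bounded_uminus: "gauge_bounded T \<Longrightarrow> gauge_bounded (\<lambda>x. - T x)"
  unfolding gauge_bounded_def by (metis scaleR_minus_right uminus_mem)

lemma gauge_bounded_diff:
  "gauge_bounded S \<Longrightarrow> gauge_bounded T \<Longrightarrow> gauge_bounded (\<lambda>x. S x - T x)"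
  using gauge_bounded_add[of S "\<lambda>x. - T x"] gauge_bounded_uminus[of T] by simp

lemma gauge_bounded_compose:
  assumes "S \<in> bounded_operators smul" "gauge_bounded S" "gauge_bounded T"
  shows "gauge_bounded (\<lambda>x. S (T x))"
proof -
  obtain a b where "0 < a" "\<And>x. x \<in> K \<Longrightarrow> \<exists>y\<in>K. S x = a *\<^sub>R y"
    "0 < b" "\<And>x. x \<in> K \<Longrightarrow> \<exists>y\<in>K. T x = b *\<^sub>R y"
    using assms(2,3) unfolding gauge_bounded_def by blast
  then show ?thesis
    unfolding gauge_bounded_def
    by (intro exI[of _ "b * a"]) (metis mult_pos_pos op_scaleR_simp[OF assms(1)] scaleR_scaleR)
qed

text \<open>\<open>g\<close> is bounded on the norm-bounded set \<open>K\<close>, and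
  \<open>y\<close> is a multiple of an element of \<open>K\<close>. The latter uses that
  \<open>y\<close> lies in the span itself and not just in its closure.\<close>

lemma gauge_bounded_rank_one:
  assumes g: "g \<in> dual_space smul" and y: "y \<in> span K"
  shows "gauge_bounded (\<lambda>x. smul (g x) y)"
proof -
  obtain a k where a: "0 < a" and k: "k \<in> K" "y = a *\<^sub>R k" using span_eq_scaled[OF y] by blast
  have "bounded (g ` K)" by (rule bounded_linear_image[OF bounded dual_linear[OF g]])
  then obtain m where m: "0 < m" "\<And>x. x \<in> K \<Longrightarrow> norm (g x) \<le> m"
    by (auto simp: bounded_pos)
  show ?thesis
    unfolding gauge_bounded_def
  proof (intro exI[of _ "a * m"] conjI ballI)
    fix x assume "x \<in> K"
    then obtain z where "z \<in> K" "smul (g x) k = m *\<^sub>R z"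
      using smul_scaleR_mem[OF k(1) m(2)] by blast
    then show "\<exists>z\<in>K. smul (g x) y = (a * m) *\<^sub>R z" using k by (auto simp: scaleR_smul)
  qed (use a m in simp)
qed

lemma gauge_bounded_sum:
  assumes "finite I" "\<And>i. i \<in> I \<Longrightarrow> gauge_bounded (T i)"
  shows "gauge_bounded (\<lambda>x. \<Sum>i\<in>I. T i x)"
  using assms
proof induction
  case empty
  then show ?case using zero_mem by (auto simp: gauge_bounded_def intro!: exI[of _ "1::real"])
qed (simp add: gauge_bounded_add)

text \<open>In the product with the candidate \<open>C\<close> for a right inverse, the terms of
  order \<open>1 / R\<close> cancel by \<open>U (U x) = x\<close>, and the term of order
  \<open>1 / (R * R)\<close> vanishes by \<open>Z (U (Z x)) = 0\<close>.\<close>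

lemma scaled_involution_covers:
  assumes U: "U \<in> bounded_operators smul" "gauge_bounded U" "\<And>x. U (U x) = x"
    and Z: "Z \<in> bounded_operators smul" "gauge_bounded Z" "\<And>x. Z (U (Z x)) = 0"
  obtains R where "(\<lambda>x. R *\<^sub>R U x + Z x) \<in> G_of smul K"
proof -
  obtain c where c: "0 < c" "\<And>x. x \<in> K \<Longrightarrow> \<exists>y\<in>K. U x = c *\<^sub>R y"
    using U(2) unfolding gauge_bounded_def by blast
  have "gauge_bounded (\<lambda>x. U (Z (U x)))"
    by (rule gauge_bounded_compose[OF U(1,2) gauge_bounded_compose[OF Z(1,2) U(2)]])
  then obtain d where d: "0 < d" "\<And>x. x \<in> K \<Longrightarrow> \<exists>y\<in>K. U (Z (U x)) = d *\<^sub>R y"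
    unfolding gauge_bounded_def by blast
  \<comment> \<open>\<open>C\<close> has gauge bound \<open>c / R + d / (R * R)\<close>, which is at
    most 1 once \<open>R\<close> is at least 1 and at least \<open>c + d\<close>.\<close>
  define R where "R = c + d + 1"
  have R: "1 \<le> R" "c + d \<le> R" using c(1) d(1) by (auto simp: R_def)
  define C where "C x = (1 / R) *\<^sub>R (U x - (1 / R) *\<^sub>R U (Z (U x)))" for x
  have "(\<lambda>x. R *\<^sub>R U x + Z x) \<in> G_of smul K"
  proof (rule G_ofI)
    show "(\<lambda>x. R *\<^sub>R U x + Z x) \<in> bounded_operators smul"
      by (intro op_add op_scaleR U Z)
    fix x assume x: "x \<in> K"
    show "R *\<^sub>R U (C x) + Z (C x) = x"
      using R(1) by (simp add: C_def op_simps[OF U(1)] op_simps[OF Z(1)] U(3) Z(3))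
    obtain y z where y: "y \<in> K" "U x = c *\<^sub>R y" and z: "z \<in> K" "U (Z (U x)) = d *\<^sub>R z"
      using c(2)[OF x] d(2)[OF x] by blast
    obtain w where w: "w \<in> K"
      "(c / R) *\<^sub>R y + (d / (R * R)) *\<^sub>R (- z) = (c / R + d / (R * R)) *\<^sub>R w"
      using add_scaleR_mem[OF y(1) uminus_mem[OF z(1)], of "c / R" "d / (R * R)"] c(1) d(1) R(1)
      by auto
    have "d / (R * R) \<le> d / R" using d(1) R(1) by (simp add: divide_left_mono)
    moreover have "c / R + d / R \<le> 1" using R by (simp flip: add_divide_distrib)
    ultimately have "c / R + d / (R * R) \<le> 1" by linarith
    then have "(c / R + d / (R * R)) *\<^sub>R w \<in> K"
      using c(1) d(1) R(1) w(1) by (intro scaleR_mem) auto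
    moreover have "C x = (c / R) *\<^sub>R y + (d / (R * R)) *\<^sub>R (- z)"
      by (simp only: C_def y(2) z(2)[unfolded y(2)]) (simp add: scaleR_diff_right)
    ultimately show "C x \<in> K" using w(2) by simp
  qed
  then show thesis by (rule that)
qed

end

section \<open>Interpolation of finitely many values by operators that cover
  \<open>K\<close>\<close>

locale infinite_dimensional_disc = bounded_disc +
  assumes infinite_dimensional: "finite A \<Longrightarrow> \<not> span K \<subseteq> span A"
begin

lemma covering_interpolation_on_basis:
  assumes F: "finite F" "F \<subseteq> dual_space smul"
    and B: "finite B" "independent B" "B \<subseteq> closure (span K)" "T ` B \<subseteq> closure (span K)"
  obtains D where "D \<in> G_of smul K" "\<And>f b. f \<in> F \<Longrightarrow> b \<in> B \<Longrightarrow> f (D b) = f (T b)"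
proof -
  \<comment> \<open>Vectors of the span that \<open>F\<close> does not see; there is room in
    \<open>N\<close> for one partner \<open>\<pi> b\<close> of each \<open>b\<close>.\<close>
  define N where "N = span K \<inter> {x. \<forall>\<phi>\<in>F. \<phi> x = 0}"
  have "\<not> N \<subseteq> span A" if "finite A" for A
    unfolding N_def
    by (rule infinite_dimensional_kernel[OF F subspace_span infinite_dimensional that])
  then have "\<exists>H\<subseteq>N. finite H \<and> card H = card B \<and> H \<inter> B = {} \<and> independent (B \<union> H)"
    by (rule extend_independent[OF _ B(1,2)])
  then obtain H where H: "H \<subseteq> N" "finite H" "card H = card B" "H \<inter> B = {}"
    "independent (B \<union> H)"
    by (elim exE conjE)
  have F_H: "f h = 0" if "h \<in> H" "f \<in> F" for h f
    using H(1) that by (auto simp: N_def)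
  obtain G where G: "\<And>b. b \<in> B \<union> H \<Longrightarrow> G b \<in> dual_space smul"
    and G_eq: "\<And>b c. b \<in> B \<union> H \<Longrightarrow> c \<in> B \<union> H \<Longrightarrow> G b c = (if b = c then 1 else 0)"
    using biorthogonal_functionals[of "B \<union> H"] B(1) H(2,5) by auto
  obtain \<pi> where \<pi>: "bij_betw \<pi> B H"
    using finite_same_card_bij[OF B(1) H(2)] H(3) by auto
  have \<pi>H: "\<pi> b \<in> H" if "b \<in> B" for b using \<pi> that by (auto simp: bij_betw_def)
  have H_span: "h \<in> span K" if "h \<in> H" for h using H(1) that by (auto simp: N_def)
  \<comment> \<open>Each \<open>b\<close> may lie only in the closure of the span, so it gets a
    substitute \<open>a b\<close> in the span. Including the functionals \<open>G\<close> here gives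
    \<open>a b\<close> the same coordinates as \<open>b\<close>.\<close>
  define \<Phi> where "\<Phi> = F \<union> G ` (B \<union> H)"
  have \<Phi>: "finite \<Phi>" "\<Phi> \<subseteq> dual_space smul"
    using F B(1) H(2) G by (auto simp: \<Phi>_def)
  have "\<forall>b\<in>B. \<exists>a. a \<in> span K \<and> (\<forall>\<phi>\<in>\<Phi>. \<phi> a = \<phi> b)"
    using exists_same_values[OF \<Phi> subspace_span[of K]] B(3) unfolding Bex_def by blast
  from bchoice[OF this] obtain a where "\<forall>b\<in>B. a b \<in> span K \<and> (\<forall>\<phi>\<in>\<Phi>. \<phi> (a b) = \<phi> b)" ..
  then have a: "\<And>b. b \<in> B \<Longrightarrow> a b \<in> span K"
    and a_eq: "\<And>b \<phi>. b \<in> B \<Longrightarrow> \<phi> \<in> \<Phi> \<Longrightarrow> \<phi> (a b) = \<phi> b" by auto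
  have "\<exists>z\<in>span K. (\<forall>f\<in>F. f z = f (T b)) \<and> (\<forall>h\<in>H. G h z = 0)" if b: "b \<in> B" for b
  proof -
    obtain y where y: "y \<in> span K" "\<And>\<phi>. \<phi> \<in> F \<Longrightarrow> \<phi> y = \<phi> (T b)"
      using exists_same_values[OF F subspace_span] B(4) b by blast
    \<comment> \<open>Removing the coordinates along \<open>H\<close> does not affect the values
      under \<open>F\<close>, and it is what later makes \<open>Z (U (Z x))\<close> vanish.\<close>
    define z where "z = y - (\<Sum>h\<in>H. smul (G h y) h)"
    have "z \<in> span K"
      unfolding z_def using y H_span by (intro span_diff span_sum span_scale) auto
    moreover have "f z = f (T b)" if "f \<in> F" for f
    proof -
      have "f \<in> dual_space smul" using F that by blast
      with y(2)[OF that] F_H[OF _ that] show ?thesis by (simp add: z_def dual_simps)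
    qed
    moreover have "G h z = 0" if "h \<in> H" for h
    proof -
      have "(\<Sum>i\<in>H. G i y * G h i) = (\<Sum>i\<in>H. if i = h then G h y else 0)"
        using that by (intro sum.cong) (auto simp: G_eq)
      also have "\<dots> = G h y" using that H(2) by simp
      finally show ?thesis using G[of h] that by (simp add: z_def dual_simps)
    qed
    ultimately show ?thesis by blast
  qed
  then have "\<forall>b\<in>B. \<exists>z. z \<in> span K \<and> (\<forall>f\<in>F. f z = f (T b)) \<and> (\<forall>h\<in>H. G h z = 0)"
    by blast
  from bchoice[OF this] obtain z where
    "\<forall>b\<in>B. z b \<in> span K \<and> (\<forall>f\<in>F. f (z b) = f (T b)) \<and> (\<forall>h\<in>H. G h (z b) = 0)" ..
  then have z: "\<And>b. b \<in> B \<Longrightarrow> z b \<in> span K"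
    and z_F: "\<And>b f. b \<in> B \<Longrightarrow> f \<in> F \<Longrightarrow> f (z b) = f (T b)"
    and z_H: "\<And>b h. b \<in> B \<Longrightarrow> h \<in> H \<Longrightarrow> G h (z b) = 0" by auto

  \<comment> \<open>\<open>\<Delta> b\<close> takes the value 2 at \<open>v b\<close> and 0 at the
    other \<open>v c\<close>. So \<open>U\<close> below is a reflection, which exchanges
    \<open>a b\<close> with \<open>\<pi> b\<close>.\<close>
  define \<Delta> where "\<Delta> b x = G b x - G (\<pi> b) x" for b x
  define v where "v b = a b - \<pi> b" for b
  have \<Delta>: "\<Delta> b \<in> dual_space smul" if "b \<in> B" for b
    unfolding \<Delta>_def using that \<pi>H by (intro dual_diff G) auto
  have v: "v b \<in> span K" if "b \<in> B" for b
    unfolding v_def using that a \<pi>H H_span by (intro span_diff) auto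
  have G_v: "G b (v c) = (if b = c then 1 else 0)" "G (\<pi> b) (v c) = (if b = c then - 1 else 0)"
    if "b \<in> B" "c \<in> B" for b c
  proof -
    have "\<pi> b = \<pi> c \<longleftrightarrow> b = c" using \<pi> that by (auto simp: bij_betw_def inj_on_def)
    moreover have "\<pi> b \<noteq> c" "b \<noteq> \<pi> c" using \<pi>H that H(4) by blast+
    moreover have "G b \<in> \<Phi>" "G (\<pi> b) \<in> \<Phi>" using that \<pi>H by (auto simp: \<Phi>_def)
    ultimately show "G b (v c) = (if b = c then 1 else 0)"
      "G (\<pi> b) (v c) = (if b = c then - 1 else 0)"
      using that \<pi>H by (simp_all add: v_def dual_simps G G_eq a_eq)
  qed
  define U where "U x = x - (\<Sum>b\<in>B. smul (\<Delta> b x) (v b))" for x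
  define Z where "Z x = (\<Sum>b\<in>B. smul (G b x) (z b))" for x
  have "U \<in> bounded_operators smul"
    unfolding U_def by (intro op_diff op_id op_sum op_rank_one \<Delta>)
  moreover have "gauge_bounded U"
    unfolding U_def
    by (intro gauge_bounded_diff gauge_bounded_id gauge_bounded_sum B gauge_bounded_rank_one \<Delta> v)
  ultimately have U: "U \<in> bounded_operators smul" "gauge_bounded U" .
  have "Z \<in> bounded_operators smul"
    unfolding Z_def by (intro op_sum op_rank_one G UnI1)
  moreover have "gauge_bounded Z"
    unfolding Z_def by (intro gauge_bounded_sum B gauge_bounded_rank_one G UnI1 z)
  ultimately have Z: "Z \<in> bounded_operators smul" "gauge_bounded Z" .
  \<comment> \<open>The first equation says that \<open>U\<close> replaces the coordinate
    \<open>G b\<close> by \<open>G (\<pi> b)\<close>.\<close>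
  have G_U: "G b (U x) = G b x - \<Delta> b x" "\<Delta> b (U x) = - \<Delta> b x" if b: "b \<in> B" for b x
  proof -
    have "(\<Sum>c\<in>B. \<Delta> c x * G b (v c)) = (\<Sum>c\<in>B. if c = b then \<Delta> b x else 0)"
      using b by (intro sum.cong) (auto simp: G_v)
    also have "\<dots> = \<Delta> b x" using b B(1) by simp
    finally show 1: "G b (U x) = G b x - \<Delta> b x"
      using b by (simp add: U_def dual_simps G)
    have "(\<Sum>c\<in>B. \<Delta> c x * G (\<pi> b) (v c)) = (\<Sum>c\<in>B. if c = b then - \<Delta> b x else 0)"
      using b by (intro sum.cong) (auto simp: G_v)
    also have "\<dots> = - \<Delta> b x" using b B(1) by simp
    finally have "G (\<pi> b) (U x) = G (\<pi> b) x + \<Delta> b x"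
      using b \<pi>H by (simp add: U_def dual_simps G)
    with 1 show "\<Delta> b (U x) = - \<Delta> b x" by (simp add: \<Delta>_def)
  qed
  have UU: "U (U x) = x" for x
  proof -
    have "U (U x) = U x + (\<Sum>b\<in>B. smul (\<Delta> b x) (v b))"
      by (simp add: U_def[of "U x"] G_U sum_negf)
    then show ?thesis by (simp add: U_def)
  qed
  have ZUZ: "Z (U (Z x)) = 0" for x
  proof -
    have "G b (U (Z x)) = 0" if "b \<in> B" for b
    proof -
      have "G b (U (Z x)) = G (\<pi> b) (Z x)" using that by (simp add: G_U \<Delta>_def)
      also have "\<dots> = 0" using that \<pi>H by (simp add: Z_def dual_simps G z_H)
      finally show ?thesis .
    qed
    then show ?thesis by (simp add: Z_def[of "U (Z x)"])
  qed
  obtain R where R: "(\<lambda>x. R *\<^sub>R U x + Z x) \<in> G_of smul K"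
    using scaled_involution_covers[OF U UU Z ZUZ] by blast
  have "f (R *\<^sub>R U b + Z b) = f (T b)" if f: "f \<in> F" and b: "b \<in> B" for f b
  proof -
    have fd: "f \<in> dual_space smul" using f F by blast
    have G_b: "G c b = (if c = b then 1 else 0)" if "c \<in> B" for c
      using that b by (simp add: G_eq)
    have "\<Delta> c b = (if c = b then 1 else 0)" if "c \<in> B" for c
    proof -
      have "\<pi> c \<noteq> b" using \<pi>H[OF that] b H(4) by blast
      then show ?thesis using that b \<pi>H by (simp add: \<Delta>_def G_eq)
    qed
    then have "(\<Sum>c\<in>B. smul (\<Delta> c b) (v c)) = (\<Sum>c\<in>B. if c = b then v b else 0)"
      by (intro sum.cong) auto
    then have "U b = b - v b" using b B(1) by (simp add: U_def)
    \<comment> \<open>Here \<open>U b = b - a b + \<pi> b\<close>, where \<open>f\<close> agrees on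
      \<open>b\<close> and \<open>a b\<close> and vanishes at \<open>\<pi> b\<close>. The summand
      \<open>R *\<^sub>R U b\<close> is thus invisible to \<open>F\<close>, however large
      \<open>R\<close> is.\<close>
    then have "f (U b) = 0"
      using f b by (simp add: v_def dual_simps fd F_H[OF \<pi>H f] a_eq[of b f] \<Phi>_def)
    moreover have "Z b = (\<Sum>c\<in>B. if c = b then z b else 0)"
      unfolding Z_def by (intro sum.cong) (auto simp: G_b)
    then have "f (Z b) = f (T b)" using b B(1) f by (simp add: z_F)
    ultimately show ?thesis by (simp add: dual_simps fd)
  qed
  with R show thesis using that by blast
qed

text \<open>Both sides of the required equation are linear in \<open>x\<close>, so it is enough to
  treat a maximal independent subset of \<open>A\<close>.\<close>

lemma covering_interpolation_closed_span:
  assumes F: "finite F" "F \<subseteq> dual_space smul"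
    and A: "finite A" "A \<subseteq> closure (span K)"
    and T: "T \<in> bounded_operators smul" "T ` closure (span K) \<subseteq> closure (span K)"
  obtains D where "D \<in> G_of smul K" "\<And>f x. f \<in> F \<Longrightarrow> x \<in> A \<Longrightarrow> f (D x) = f (T x)"
proof -
  obtain B where B: "B \<subseteq> A" "independent B" "A \<subseteq> span B"
    using maximal_independent_subset[of A] by blast
  have "finite B" using B(1) A(1) by (rule finite_subset)
  moreover have "B \<subseteq> closure (span K)" using B(1) A(2) by blast
  moreover from this T(2) have "T ` B \<subseteq> closure (span K)" by blast
  ultimately obtain D where D: "D \<in> G_of smul K" "\<And>f b. f \<in> F \<Longrightarrow> b \<in> B \<Longrightarrow> f (D b) = f (T b)"
    using covering_interpolation_on_basis[OF F _ B(2), of T] by blast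
  have Db: "D \<in> bounded_operators smul" using D(1) by (simp add: G_of_def)
  have "f (D x) = f (T x)" if f: "f \<in> F" and x: "x \<in> A" for f x
  proof -
    have fd: "f \<in> dual_space smul" using f F by blast
    have "x \<in> span B" using x B(3) by blast
    then show ?thesis
    proof (rule span_induct)
      show "subspace {x. f (D x) = f (T x)}"
        by (auto simp: subspace_def op_simps[OF Db] op_simps[OF T(1)] dual_simps[OF fd])
    qed (use D(2) f in auto)
  qed
  with D(1) show thesis using that by blast
qed

lemma covering_interpolation:
  assumes F: "finite F" "F \<subseteq> dual_space smul" and A: "finite A" and T: "T \<in> A_of smul K"
  obtains D where "D \<in> G_of smul K" "\<And>f x. f \<in> F \<Longrightarrow> x \<in> A \<Longrightarrow> f (D x) = f (T x)"
proof -
  have T': "T \<in> bounded_operators smul" "T ` closure (span K) \<subseteq> closure (span K)"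
    using T by (auto simp: A_of_def V_of_def)
  obtain P where P: "P \<in> bounded_operators smul" "\<And>x. x \<in> closure (span K) \<Longrightarrow> P x = 0"
    "\<And>x. x \<in> A \<Longrightarrow> x - P x \<in> closure (span K)"
    using finite_rank_retraction_modulo[OF A subspace_closure[OF subspace_span] closed_closure]
    by blast
  obtain E where E: "E \<in> G_of smul K"
    "\<And>f x. f \<in> F \<Longrightarrow> x \<in> (\<lambda>x. x - P x) ` A \<Longrightarrow> f (E x) = f (T x)"
    using covering_interpolation_closed_span[OF F _ _ T', of "(\<lambda>x. x - P x) ` A"] A P(3) by blast
  have Eb: "E \<in> bounded_operators smul" and EK: "K \<subseteq> E ` K" using E(1) by (auto simp: G_of_def)
  \<comment> \<open>On \<open>K\<close> the operator \<open>P\<close> vanishes, so \<open>D\<close>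
    covers \<open>K\<close> as \<open>E\<close> does. On \<open>A\<close> the values of
    \<open>E\<close> are correct at \<open>x - P x\<close>, and \<open>T\<close> itself is used on
    the rest.\<close>
  define D where "D x = E (x - P x) + T (P x)" for x
  have "D \<in> bounded_operators smul"
    unfolding D_def by (intro op_add op_compose[OF Eb] op_compose[OF T'(1)] op_diff op_id P(1))
  moreover have "D x = E x" if "x \<in> K" for x
    using P(2)[of x] that span_base[of x K] subsetD[OF closure_subset, of x "span K"]
    by (auto simp: D_def op_simps[OF T'(1)])
  then have "D ` K = E ` K" by simp
  ultimately have "D \<in> G_of smul K" using EK by (simp add: G_of_def)
  moreover have "f (D x) = f (T x)" if "f \<in> F" "x \<in> A" for f x
  proof -
    have "f \<in> dual_space smul" using F that by blast
    with E(2)[of f "x - P x"] that show ?thesis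
      by (simp add: D_def dual_simps op_simps[OF T'(1)])
  qed
  ultimately show thesis using that by blast
qed

end

section \<open>Kolmogorov widths and the weak operator topology\<close>

context banach_space_over
begin

text \<open>Widths are defined by subspaces of exact dimension, whereas approximating sets may be
  dependent or too small. \<open>B\<close> shows that the space is large enough to fill them
  up.\<close>

lemma spanning_independent_of_card:
  assumes B: "finite B" "independent B" "card B = m" and E: "finite E" "card E \<le> m"
  obtains C where "finite C" "independent C" "card C = m" "E \<subseteq> span C"
proof -
  obtain E0 where E0: "E0 \<subseteq> E" "independent E0" "E \<subseteq> span E0"
    using maximal_independent_subset[of E] by blast
  have fin: "finite E0" "card E0 \<le> m"
    using E0(1) E card_mono[OF E(1) E0(1)] by (auto intro: finite_subset)
  have "\<exists>C. E0 \<subseteq> C \<and> finite C \<and> independent C \<and> card C = card E0 + k"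
    if "card E0 + k \<le> m" for k
    using that
  proof (induction k)
    case 0
    then show ?case using E0(2) fin by auto
  next
    case (Suc k)
    then obtain C where C: "E0 \<subseteq> C" "finite C" "independent C" "card C = card E0 + k" by auto
    \<comment> \<open>By the exchange principle, since \<open>C\<close> still has fewer than
      \<open>m\<close> elements.\<close>
    have "\<not> B \<subseteq> span C"
      using independent_span_bound[OF C(2) B(2)] B(3) C(4) Suc.prems by auto
    then obtain b where b: "b \<in> B" "b \<notin> span C" by blast
    then have "b \<notin> C" by (auto intro: span_base)
    with C b show ?case by (intro exI[of _ "insert b C"]) (auto simp: independent_insert)
  qed
  from this[of "m - card E0"] fin(2)
  obtain C where C: "E0 \<subseteq> C" "finite C" "independent C" "card C = m" by auto
  then show thesis using that E0(3) span_mono[OF C(1)] by blast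
qed

lemma kolmogorov_width_le:
  assumes B: "finite B" "independent B" "card B = m" and E: "finite E" "card E \<le> m"
    and approx: "\<And>x. x \<in> K \<Longrightarrow> \<exists>z\<in>span E. norm (x - z) \<le> e"
  shows "kolmogorov_width smul m K \<le> ereal e"
proof -
  obtain C where C: "finite C" "independent C" "card C = m" "E \<subseteq> span C"
    using spanning_independent_of_card[OF B E] by blast
  have "span E \<subseteq> span C" using span_minimal[OF C(4)] by simp
  show ?thesis
    unfolding kolmogorov_width_def
  proof (rule INF_lower2)
    show "span C \<in> subspaces_of_dim smul m" using C by (auto simp: subspaces_of_dim_def)
    show "(SUP x\<in>K. INF z\<in>span C. ereal (norm (x - z))) \<le> ereal e"
    proof (rule SUP_least)
      fix x assume "x \<in> K"
      then obtain z where "z \<in> span C" "norm (x - z) \<le> e"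
        using approx \<open>span E \<subseteq> span C\<close> by blast
      then show "(INF z\<in>span C. ereal (norm (x - z))) \<le> ereal e" by (intro INF_lower2) auto
    qed
  qed
qed

lemma kolmogorov_width_lessD:
  assumes "kolmogorov_width smul m K < ereal e"
  obtains B where "finite B" "independent B" "card B = m"
    "\<forall>x\<in>K. \<exists>z\<in>span B. norm (x - z) < e"
proof -
  obtain B where B: "finite B" "independent B" "card B = m"
    "(SUP x\<in>K. INF z\<in>span B. ereal (norm (x - z))) < ereal e"
    using assms unfolding kolmogorov_width_def INF_less_iff subspaces_of_dim_def by blast
  have "\<forall>x\<in>K. \<exists>z\<in>span B. norm (x - z) < e"
  proof
    fix x assume "x \<in> K"
    have "(INF z\<in>span B. ereal (norm (x - z))) < ereal e"
      using SUP_upper[OF \<open>x \<in> K\<close>] B(4) by (rule order.strict_trans1)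
    then show "\<exists>z\<in>span B. norm (x - z) < e" by (simp add: INF_less_iff)
  qed
  then show thesis by (rule that[OF B(1-3)])
qed

text \<open>If \<open>n\<close> vectors spanned \<open>K\<close>, the width of index
  \<open>n + 1\<close> would be 0; its finiteness provides the \<open>n + 1\<close> independent
  vectors required for that bound.\<close>

lemma infinite_dimensional_if_widths_pos:
  assumes "\<And>n. 0 < kolmogorov_width smul (Suc n) K" "\<And>n. kolmogorov_width smul (Suc n) K < \<infinity>"
    and "finite A"
  shows "\<not> span K \<subseteq> span A"
proof
  assume A: "span K \<subseteq> span A"
  define n where "n = card A"
  obtain e where e: "kolmogorov_width smul (Suc n) K < ereal e"
    using ereal_dense2[OF assms(2)[of n]] by blast
  obtain B where B: "finite B" "independent B" "card B = Suc n"
    by (rule kolmogorov_width_lessD[OF e])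
  have "kolmogorov_width smul (Suc n) K \<le> ereal 0"
  proof (rule kolmogorov_width_le[OF B assms(3)])
    fix x assume "x \<in> K"
    then show "\<exists>z\<in>span A. norm (x - z) \<le> 0" using A span_base by (intro bexI[of _ x]) auto
  qed (simp add: n_def)
  with assms(1)[of n] show False by (simp add: zero_ereal_def)
qed

text \<open>The functional \<open>g \<circ> D\<close> is 1 at \<open>k0\<close> but vanishes at
  every \<open>k\<close> with \<open>D k\<close> in \<open>K\<close>. Hence approximants of such
  \<open>k\<close> can be moved into its kernel at a cost proportional to \<open>e\<close>, which
  saves one dimension.\<close>

lemma kolmogorov_width_image_le:
  assumes D: "D \<in> bounded_operators smul" "K \<subseteq> D ` K"
    and g: "g \<in> dual_space smul" "\<And>x. x \<in> K \<Longrightarrow> g x = 0"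
    and k0: "k0 \<in> K" "g (D k0) = 1"
  obtains C d where "0 < C" "0 < d"
    "\<And>n e. kolmogorov_width smul (Suc n) K < ereal e \<Longrightarrow> e < d \<Longrightarrow>
      kolmogorov_width smul n K \<le> ereal (C * e)"
proof -
  define \<gamma> where "\<gamma> x = g (D x)" for x
  have \<gamma>: "\<gamma> \<in> dual_space smul" unfolding \<gamma>_def by (rule dual_compose[OF g(1) D(1)])
  obtain M where M: "0 < M" "\<And>x. norm (\<gamma> x) \<le> norm x * M"
    using bounded_linear.pos_bounded[OF dual_linear[OF \<gamma>]] by blast
  obtain N where N: "0 < N" "\<And>x. norm (D x) \<le> norm x * N"
    using bounded_linear.pos_bounded[OF op_linear[OF D(1)]] by blast
  \<comment> \<open>The bracket bounds \<open>norm (k - t) / e\<close> for the corrected approximant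
    \<open>t\<close> below, and \<open>N\<close> bounds \<open>D\<close>.\<close>
  define C where "C = N * (1 + 2 * M * (norm k0 + 1))"
  \<comment> \<open>Below \<open>1 / (2 * M)\<close> the value of \<open>\<gamma>\<close> at the
    approximant \<open>s0\<close> of \<open>k0\<close> has norm at least 1/2; below 1,
    \<open>s0\<close> has norm at most \<open>norm k0 + 1\<close>.\<close>
  define d where "d = min 1 (1 / (2 * M))"
  have "0 < C" using M(1) N(1) unfolding C_def
    by (intro mult_pos_pos add_pos_nonneg mult_nonneg_nonneg) auto
  moreover have "0 < d" using M(1) by (simp add: d_def)
  moreover have "kolmogorov_width smul n K \<le> ereal (C * e)"
    if w: "kolmogorov_width smul (Suc n) K < ereal e" and e: "e < d" for n e
  proof -
    obtain B where B: "finite B" "independent B" "card B = Suc n"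
      and approx: "\<forall>x\<in>K. \<exists>z\<in>span B. norm (x - z) < e"
      by (rule kolmogorov_width_lessD[OF w])
    obtain s0 where s0: "s0 \<in> span B" "norm (k0 - s0) < e" using approx k0(1) by blast
    have e_pos: "0 < e" using s0(2) norm_ge_zero[of "k0 - s0"] by linarith
    have eM: "e * M \<le> 1 / 2" and e1: "e \<le> 1" using e M(1) by (auto simp: d_def field_simps)
    have \<gamma>_s0: "1 / 2 \<le> norm (\<gamma> s0)"
    proof -
      have "norm (k0 - s0) * M \<le> e * M" using s0(2) M(1) by simp
      then have "norm (1 - \<gamma> s0) \<le> e * M"
        using M(2)[of "k0 - s0"] k0(2) by (simp add: dual_diff_simp[OF \<gamma>] \<gamma>_def[of k0])
      then show ?thesis using eM norm_triangle_ineq[of "1 - \<gamma> s0" "\<gamma> s0"] by simp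
    qed
    have norm_s0: "norm s0 \<le> norm k0 + 1"
      using s0(2) e1 norm_triangle_sub[of s0 k0] by (simp add: norm_minus_commute)
    have "\<exists>b\<in>B. \<gamma> b \<noteq> 0"
    proof (rule ccontr)
      assume "\<not> (\<exists>b\<in>B. \<gamma> b \<noteq> 0)"
      then have "\<gamma> s0 = 0"
        using span_induct[OF s0(1), of "\<lambda>x. \<gamma> x = 0"]
        by (auto simp: subspace_def dual_simps[OF \<gamma>])
      with \<gamma>_s0 show False by simp
    qed
    then obtain b where b: "b \<in> B" "\<gamma> b \<noteq> 0" by blast
    \<comment> \<open>\<open>D\<close> after the projection along \<open>b\<close> onto the kernel
      of \<open>\<gamma>\<close>. It kills \<open>b\<close>, so the images of the other
      \<open>n\<close> basis vectors span its image of \<open>span B\<close>, and it agrees with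
      \<open>D\<close> on the kernel.\<close>
    define L where "L x = D x - smul (\<gamma> x / \<gamma> b) (D b)" for x
    have L: "L \<in> bounded_operators smul"
      using op_diff[OF D(1) op_rank_one[OF \<gamma>, of "smul (1 / \<gamma> b) (D b)"]]
      by (simp add: L_def[abs_def])
    define E where "E = L ` (B - {b})"
    have "L b = 0" using b(2) by (simp add: L_def)
    then have "L ` B = insert 0 E"
      unfolding E_def by (metis b(1) image_insert insert_Diff)
    then have L_span: "L x \<in> span E" if "x \<in> span B" for x
      using that op_image_span[OF L, of B] by auto
    show ?thesis
    proof (rule kolmogorov_width_le)
      show "finite (B - {b})" "independent (B - {b})" "card (B - {b}) = n" "finite E"
        using B b independent_mono[OF B(2) Diff_subset] by (auto simp: E_def)
      then show "card E \<le> n" unfolding E_def by (metis card_image_le)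
      fix x assume "x \<in> K"
      then obtain k where k: "k \<in> K" "x = D k" using D(2) by blast
      obtain s where s: "s \<in> span B" "norm (k - s) < e" using approx k(1) by blast
      \<comment> \<open>The correction is made along \<open>s0\<close> and not along
        \<open>b\<close>, because only \<open>\<gamma> s0\<close> is bounded away from 0
        uniformly.\<close>
      define t where "t = s - smul (\<gamma> s / \<gamma> s0) s0"
      have "t \<in> span B" unfolding t_def using s(1) s0(1) by (intro span_diff span_scale)
      moreover have "\<gamma> t = 0" using \<gamma>_s0 by (auto simp: t_def dual_simps[OF \<gamma>])
      ultimately have "D t \<in> span E" using L_span[of t] by (simp add: L_def)
      moreover have "norm (x - D t) \<le> C * e"
      proof -
        have "\<gamma> k = 0" using g(2)[OF \<open>x \<in> K\<close>] by (simp add: \<gamma>_def k(2))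
        moreover have "norm (k - s) * M \<le> e * M" using s(2) M(1) by simp
        ultimately have \<gamma>_s: "norm (\<gamma> s) \<le> e * M"
          using M(2)[of "k - s"] by (simp add: dual_diff_simp[OF \<gamma>])
        have "norm (\<gamma> s / \<gamma> s0) \<le> (e * M) / (1 / 2)"
          unfolding norm_divide using \<gamma>_s \<gamma>_s0 e_pos M(1) by (intro frac_le) auto
        then have "norm (\<gamma> s / \<gamma> s0) * norm s0 \<le> (e * M) / (1 / 2) * (norm k0 + 1)"
          using norm_s0 e_pos M(1) by (intro mult_mono) auto
        moreover have "norm (k - t) \<le> norm (k - s) + norm (smul (\<gamma> s / \<gamma> s0) s0)"
          using norm_triangle_ineq[of "k - s" "smul (\<gamma> s / \<gamma> s0) s0"]
          by (simp add: t_def algebra_simps)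
        ultimately have "norm (k - t) \<le> e * (1 + 2 * M * (norm k0 + 1))"
          using s(2) by (simp add: norm_scale algebra_simps)
        then have "norm (k - t) * N \<le> e * (1 + 2 * M * (norm k0 + 1)) * N"
          using N(1) by (intro mult_right_mono) auto
        moreover have "norm (x - D t) \<le> norm (k - t) * N"
          using N(2)[of "k - t"] by (simp add: k(2) op_simps[OF D(1)])
        ultimately show ?thesis by (simp add: C_def mult_ac)
      qed
      ultimately show "\<exists>z\<in>span E. norm (x - z) \<le> C * e" by blast
    qed
  qed
  ultimately show thesis using that by blast
qed

section \<open>The weak operator topology\<close>

lemma topspace_weak_operator_topology:
  "topspace (weak_operator_topology smul) = bounded_operators smul"
proof -
  have "(\<lambda>x. 0) \<in> dual_space smul" by (simp add: dual_space_def)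
  then show ?thesis
    unfolding weak_operator_topology_def topology_generated_by_topspace by blast
qed

lemma openin_weak_operator_topology:
  "f \<in> dual_space smul \<Longrightarrow> open U \<Longrightarrow>
    openin (weak_operator_topology smul) {T \<in> bounded_operators smul. f (T x) \<in> U}"
  unfolding weak_operator_topology_def
  by (rule topology_generated_by_Basis) blast

text \<open>By separation, \<open>T\<close> fails to preserve \<open>V\<close> exactly when some
  functional vanishing on \<open>V\<close> is nonzero at some \<open>T x\<close> with
  \<open>x\<close> in \<open>V\<close>; each such condition is open.\<close>

lemma closedin_A_of:
  "closedin (weak_operator_topology smul) (A_of smul K)"
proof -
  define V where "V = V_of smul K"
  have V: "subspace V" "closed V"
    by (simp_all add: V_def V_of_def subspace_closure)
  have "bounded_operators smul - A_of smul K = \<Union>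
    {{T \<in> bounded_operators smul. f (T x) \<in> - {0}} | f x.
      f \<in> dual_space smul \<and> (\<forall>v\<in>V. f v = 0) \<and> x \<in> V}" (is "_ = \<Union>?\<O>")
  proof (intro equalityI subsetI)
    fix T assume T: "T \<in> bounded_operators smul - A_of smul K"
    then obtain x where x: "x \<in> V" "T x \<notin> V" by (auto simp: A_of_def V_def)
    obtain f where f: "f \<in> dual_space smul" "\<And>v. v \<in> V \<Longrightarrow> f v = 0" "f (T x) = 1"
      using hahn_banach_separation[OF V x(2)] by blast
    have "{T \<in> bounded_operators smul. f (T x) \<in> - {0}} \<in> ?\<O>" using f(1,2) x(1) by blast
    then show "T \<in> \<Union>?\<O>" using T f(3) by (intro UnionI) auto
  next
    fix T assume "T \<in> \<Union>?\<O>"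
    then show "T \<in> bounded_operators smul - A_of smul K"
      by (auto simp: A_of_def V_def)
  qed
  moreover have "openin (weak_operator_topology smul) (\<Union>?\<O>)"
  proof (rule openin_Union)
    fix S assume "S \<in> ?\<O>"
    then obtain f x where "S = {T \<in> bounded_operators smul. f (T x) \<in> - {0}}"
      "f \<in> dual_space smul" by blast
    then show "openin (weak_operator_topology smul) S"
      using openin_weak_operator_topology[of f "- {0}" x] by (simp add: open_Compl)
  qed
  ultimately show ?thesis
    by (auto simp: closedin_def topspace_weak_operator_topology A_of_def)
qed

text \<open>Exact agreement at finitely many pairs takes the place of the usual epsilon, which
  matches the exact interpolation above. The induction follows the generation of the topology from
  its subbasis.\<close>

lemma weak_operator_nhds:
  assumes "openin (weak_operator_topology smul) W" "T \<in> W"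
  obtains F A where "finite F" "F \<subseteq> dual_space smul" "finite A"
    "\<And>D. D \<in> bounded_operators smul \<Longrightarrow> (\<And>f x. f \<in> F \<Longrightarrow> x \<in> A \<Longrightarrow> f (D x) = f (T x)) \<Longrightarrow> D \<in> W"
proof -
  define S where "S = {{T \<in> bounded_operators smul. f (T x) \<in> U} | f x U.
    f \<in> dual_space smul \<and> open U}"
  have "generate_topology_on S W"
    using assms(1) by (simp add: weak_operator_topology_def S_def openin_topology_generated_by_iff)
  then have "\<exists>F A. finite F \<and> F \<subseteq> dual_space smul \<and> finite A \<and>
    (\<forall>D\<in>bounded_operators smul. (\<forall>f\<in>F. \<forall>x\<in>A. f (D x) = f (T x)) \<longrightarrow> D \<in> W)"
    using assms(2)
  proof induction
    case (Int a b)
    then obtain F A F' A' where "finite F" "F \<subseteq> dual_space smul" "finite A"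
      "\<forall>D\<in>bounded_operators smul. (\<forall>f\<in>F. \<forall>x\<in>A. f (D x) = f (T x)) \<longrightarrow> D \<in> a"
      "finite F'" "F' \<subseteq> dual_space smul" "finite A'"
      "\<forall>D\<in>bounded_operators smul. (\<forall>f\<in>F'. \<forall>x\<in>A'. f (D x) = f (T x)) \<longrightarrow> D \<in> b"
      by auto
    then show ?case by (intro exI[of _ "F \<union> F'"] exI[of _ "A \<union> A'"]) auto
  next
    case (UN \<O>)
    from UN.prems obtain U where U: "U \<in> \<O>" "T \<in> U" by blast
    have "U \<subseteq> \<Union>\<O>" using U(1) by blast
    with UN.IH[OF U] show ?case unfolding subset_iff by meson
  next
    case (Basis s)
    then obtain f x U where "s = {T \<in> bounded_operators smul. f (T x) \<in> U}" "f \<in> dual_space smul"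
      by (auto simp: S_def)
    with Basis.prems show ?case by (intro exI[of _ "{f}"] exI[of _ "{x}"]) simp
  qed simp
  then obtain F A where FA: "finite F" "F \<subseteq> dual_space smul" "finite A"
    "\<forall>D\<in>bounded_operators smul. (\<forall>f\<in>F. \<forall>x\<in>A. f (D x) = f (T x)) \<longrightarrow> D \<in> W"
    by (elim exE conjE)
  show thesis by (rule that[OF FA(1-3)]) (simp add: FA(4)[rule_format])
qed

text \<open>If \<open>D\<close> moved a point of \<open>K\<close> out of \<open>V\<close>, the width
  comparison would keep the quotients of consecutive widths above a positive constant from some
  index on.\<close>

lemma G_of_subset_A_of:
  assumes lac: "lacunary (\<lambda>n. kolmogorov_width smul (Suc n) K)"
  shows "G_of smul K \<subseteq> A_of smul K"
proof
  fix D assume D_G: "D \<in> G_of smul K"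
  then have D: "D \<in> bounded_operators smul" "K \<subseteq> D ` K" by (auto simp: G_of_def)
  define V where "V = V_of smul K"
  have V: "subspace V" "closed V" "V = closure (span K)"
    by (simp_all add: V_def V_of_def subspace_closure)
  define a where "a n = kolmogorov_width smul (Suc n) K" for n
  have a: "\<And>n. 0 < a n" "\<And>n. a n < \<infinity>" "a \<longlonglongrightarrow> 0" "liminf (\<lambda>n. a (Suc n) / a n) = 0"
    using lac by (simp_all add: lacunary_def a_def[abs_def])
  have "D ` K \<subseteq> V"
  proof (rule ccontr)
    assume "\<not> D ` K \<subseteq> V"
    then obtain k0 where k0: "k0 \<in> K" "D k0 \<notin> V" by blast
    obtain g where g: "g \<in> dual_space smul" "\<And>x. x \<in> V \<Longrightarrow> g x = 0" "g (D k0) = 1"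
      using hahn_banach_separation[OF V(1,2) k0(2)] by blast
    have g_K: "g x = 0" if "x \<in> K" for x
      using g(2)[of x] that span_base[of x K] subsetD[OF closure_subset, of x "span K"] V(3) by simp
    obtain C d where C: "0 < C" "0 < d"
      and width: "\<And>n e. kolmogorov_width smul (Suc n) K < ereal e \<Longrightarrow> e < d \<Longrightarrow>
        kolmogorov_width smul n K \<le> ereal (C * e)"
      using kolmogorov_width_image_le[OF D g(1) g_K k0(1) g(3)] by blast
    have "\<forall>\<^sub>F n in sequentially. a n < ereal (d / 2)"
      using order_tendstoD(2)[OF a(3), of "ereal (d / 2)"] C(2) by simp
    then have "\<forall>\<^sub>F n in sequentially. a (Suc n) < ereal (d / 2)"
      by (rule eventually_sequentially_Suc[THEN iffD2])
    then have "\<forall>\<^sub>F n in sequentially. ereal (1 / (2 * C)) \<le> a (Suc n) / a n"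
    proof (rule eventually_mono)
      fix n assume n: "a (Suc n) < ereal (d / 2)"
      obtain r where r: "a (Suc n) = ereal r" "0 < r"
        using a(1,2)[of "Suc n"] by (cases "a (Suc n)") auto
      obtain s where s: "a n = ereal s" "0 < s"
        using a(1,2)[of n] by (cases "a n") auto
      \<comment> \<open>The comparison asks for a level strictly above the width, hence
        \<open>2 * r\<close>, which is still below \<open>d\<close>. As \<open>a n\<close> is the
        width of index \<open>n + 1\<close>, it is used at \<open>Suc n\<close>.\<close>
      have "a n \<le> ereal (C * (2 * r))"
        using width[of "Suc n" "2 * r"] n r by (simp add: a_def)
      then have "s \<le> C * (2 * r)" using s by simp
      then show "ereal (1 / (2 * C)) \<le> a (Suc n) / a n"
        using r s C(1) by (simp add: field_simps)
    qed
    then have "ereal (1 / (2 * C)) \<le> liminf (\<lambda>n. a (Suc n) / a n)"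
      by (rule Liminf_bounded)
    with a(4) C(1) show False by (simp add: zero_ereal_def)
  qed
  then have "D ` span K \<subseteq> V" using V(1) by (simp add: op_image_span[OF D(1)] span_minimal)
  then have "D ` V \<subseteq> V" using op_image_closure[OF D(1)] V by (metis closure_closed)
  with D(1) show "D \<in> A_of smul K" by (simp add: A_of_def V_def)
qed

end

theorem theorem3p7:
  fixes smul :: "'k::real_or_complex \<Rightarrow> 'a::banach \<Rightarrow> 'a"
    and K :: "'a set"
  assumes "banach_space_over smul"
    and "compact K"
    and "absolutely_convex smul K"
    and "lacunary (\<lambda>n. kolmogorov_width smul (Suc n) K)"
  shows "WG_of smul K = A_of smul K"
proof -
  interpret banach_space_over smul by fact
  have widths: "0 < kolmogorov_width smul (Suc n) K" "kolmogorov_width smul (Suc n) K < \<infinity>" for n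
    using assms(4) by (simp_all add: lacunary_def)
  interpret infinite_dimensional_disc smul K
  proof
    show inf: "\<not> span K \<subseteq> span A" if "finite A" for A
      by (rule infinite_dimensional_if_widths_pos[OF widths that])
    \<comment> \<open>The empty set has the span of \<open>{}\<close>, which infinite dimension
      excludes.\<close>
    show "K \<noteq> {}" using inf[of "{}"] by auto
  qed (use assms(2,3) in \<open>auto simp: compact_imp_bounded\<close>)
  show ?thesis
  proof
    show "WG_of smul K \<subseteq> A_of smul K"
      unfolding WG_of_def
      by (rule closure_of_minimal[OF G_of_subset_A_of[OF assms(4)] closedin_A_of])
    show "A_of smul K \<subseteq> WG_of smul K"
    proof
      fix T assume T: "T \<in> A_of smul K"
      show "T \<in> WG_of smul K"
        unfolding WG_of_def in_closure_of
      proof (intro conjI allI impI)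
        show "T \<in> topspace (weak_operator_topology smul)"
          using T by (simp add: topspace_weak_operator_topology A_of_def)
        fix W assume W: "T \<in> W \<and> openin (weak_operator_topology smul) W"
        then obtain F A where F: "finite F" "F \<subseteq> dual_space smul" "finite A"
          and FW: "\<And>D. D \<in> bounded_operators smul \<Longrightarrow>
            (\<And>f x. f \<in> F \<Longrightarrow> x \<in> A \<Longrightarrow> f (D x) = f (T x)) \<Longrightarrow> D \<in> W"
          using weak_operator_nhds by metis
        obtain D where "D \<in> G_of smul K" "\<And>f x. f \<in> F \<Longrightarrow> x \<in> A \<Longrightarrow> f (D x) = f (T x)"
          using covering_interpolation[OF F T] by blast
        with FW[of D] show "\<exists>D. D \<in> G_of smul K \<and> D \<in> W" by (auto simp: G_of_def)
      qed
    qed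
  qed
qed

end
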